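(* Let $d\ge 1$, let $A\in GL_d(\mathbb{Q})$ have no (complex) eigenvalue of norm $1$, and let $G=\mathbb{Z}\ltimes_A H$, where $H\subset\mathbb{Q}^d$ is a subgroup with $A(H)=H$ and $\mathrm{rank}_{\mathbb{Q}}(H)=d$; let $a\in G$ be the generator of $\mathbb{Z}$ (whose action on $H$ is given by $A$). Assume that $G$ acts by orientation-preserving $C^1$ diffeomorphisms of $[0,1]$ with no global fixed point in $(0,1)$ and that the image group is non-Abelian. Let $\psi:G\to\mathrm{Aff}_+(\mathbb{R})$ be a homomorphism to which the action on $(0,1)$ is topologically conjugate, and let $\lambda$ be the ratio of the homothety $\psi(a)$. Then the derivative of $a$ at its fixed point in $(0,1)$ equals $\lambda$. More generally, for each integer $k\neq 0$ and all $b\in H$, the derivative of $a^k b$ at its fixed point in $(0,1)$ equals $\lambda^k$.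
   Context: The $\mathbb{Q}$-rank of $H$, $\mathrm{rank}_{\mathbb{Q}}(H)$, is the smallest $d'$ such that $H$ embeds into $\mathbb{Q}^{d'}$. $\mathbb{Z}\ltimes_A H$ is the semidirect product in which the generator $a$ of $\mathbb{Z}$ acts on $H$ by $a\,b\,a^{-1}=A(b)$, $b\in H$. A global fixed point of a group is a point fixed by all its elements. $\mathrm{Aff}_+(\mathbb{R})$ is the group of maps $x\mapsto\lambda x+t$ with $\lambda>0$, $t\in\mathbb{R}$; the ratio of such a map is $\lambda$, and it is a homothety if $\lambda\ne1$. Under the stated hypotheses there is a homomorphism $\psi:G\to\mathrm{Aff}_+(\mathbb{R})$ and a homeomorphism $\varphi:(0,1)\to\mathbb{R}$ with $\varphi\circ g=\psi(g)\circ\varphi$ on $(0,1)$ for all $g\in G$ (this is the meaning of "topologically conjugate"); its image is non-Abelian, $\psi(H)$ consists of translations and $\psi(a)$ is a homothety of ratio $\lambda\neq1$, so that $a$ and each $a^kb$ ($k\ne0$, $b\in H$) have exactly one fixed point in $(0,1)$. *)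

theory Defs
  imports
    "HOL-Analysis.Analysis"
    "HOL-Algebra.Group_Action"
    "Jordan_Normal_Form.Char_Poly"
begin

abbreviation rat_space :: "nat \<Rightarrow> rat vec monoid" where
  "rat_space n \<equiv> monoid_vec TYPE(rat) n"

abbreviation GL_rat :: "nat \<Rightarrow> rat mat monoid" where
  "GL_rat n \<equiv> units_of (ring_mat TYPE(rat) n ())"

text \<open>The minimum exists for every subgroup of some \<open>rat_space d\<close>, since it embeds in
  \<open>rat_space d\<close> itself; for other groups the value is unspecified.\<close>

definition rat_rank :: "('b, 'c) monoid_scheme \<Rightarrow> nat" where
  "rat_rank K = (LEAST n. mon K (rat_space n) \<noteq> {})"

text \<open>The pair \<open>(m, b)\<close> stands for the product \<open>b a\<^sup>m\<close> (not \<open>a\<^sup>m b\<close>), where \<open>a\<close> generates the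
  factor of integers.  The multiplication is then forced by \<open>a b a\<^sup>-\<^sup>1 = A b\<close>; see
  \<open>int_semidirect_conj\<close> below.\<close>

definition int_semidirect :: "nat \<Rightarrow> rat mat \<Rightarrow> rat vec set \<Rightarrow> (int \<times> rat vec) monoid" where
  "int_semidirect d A H =
    \<lparr>carrier = UNIV \<times> H,
     mult = (\<lambda>(m, b) (n, c). (m + n, b + (A [^]\<^bsub>GL_rat d\<^esub> m) *\<^sub>v c)),
     one = (0, 0\<^sub>v d)\<rparr>"

definition int_gen :: "nat \<Rightarrow> int \<times> rat vec" where
  "int_gen d = (1, 0\<^sub>v d)"

definition of_normal :: "rat vec \<Rightarrow> int \<times> rat vec" where
  "of_normal b = (0, b)"

text \<open>One-sided derivatives are used at boundary points of \<open>S\<close>; the library predicate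
  \<open>C1_differentiable_on\<close> takes two-sided derivatives there, so it also depends on the values
  outside \<open>S\<close>.\<close>

definition C1_on :: "real set \<Rightarrow> (real \<Rightarrow> real) \<Rightarrow> bool" where
  "C1_on S f \<longleftrightarrow>
    (\<exists>f'. (\<forall>x\<in>S. (f has_real_derivative f' x) (at x within S)) \<and> continuous_on S f')"

definition C1_diffeo_on :: "real set \<Rightarrow> (real \<Rightarrow> real) \<Rightarrow> bool" where
  "C1_diffeo_on S f \<longleftrightarrow> bij_betw f S S \<and> C1_on S f \<and> C1_on S (inv_into S f)"

definition Aff_plus :: "(real \<Rightarrow> real) monoid" where
  "Aff_plus = \<lparr>carrier = {f. \<exists>l t. 0 < l \<and> f = (\<lambda>x. l * x + t)}, mult = (\<circ>), one = id\<rparr>"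

definition aff_ratio :: "(real \<Rightarrow> real) \<Rightarrow> real" where
  "aff_ratio f = (THE l. \<exists>t. f = (\<lambda>x. l * x + t))"

text \<open>The conjugating homeomorphism may reverse the orientation.\<close>

definition topologically_conjugate_to ::
  "('g, 'c) monoid_scheme \<Rightarrow> ('g \<Rightarrow> real \<Rightarrow> real) \<Rightarrow> ('g \<Rightarrow> real \<Rightarrow> real) \<Rightarrow> bool" where
  "topologically_conjugate_to G \<Phi> \<psi> \<longleftrightarrow>
    (\<exists>h h'. homeomorphism {0<..<1} UNIV h h' \<and>
      (\<forall>g\<in>carrier G. \<forall>x\<in>{0<..<1}. h (\<Phi> g x) = \<psi> g (h x)))"

lemma aff_ratio_affine [simp]: "aff_ratio (\<lambda>x. l * x + t) = l"
proof -
  have "l' = l" if "(\<lambda>x::real. l * x + t) = (\<lambda>x. l' * x + t')" for l' t'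
    using fun_cong[OF that, of 0] fun_cong[OF that, of 1] by simp
  then show ?thesis unfolding aff_ratio_def by blast
qed

lemma group_Aff_plus: "group Aff_plus"
proof (rule groupI)
  fix f assume "f \<in> carrier Aff_plus"
  then obtain l t where f: "0 < l" "f = (\<lambda>x. l * x + t)" by (auto simp: Aff_plus_def)
  show "\<exists>g\<in>carrier Aff_plus. g \<otimes>\<^bsub>Aff_plus\<^esub> f = \<one>\<^bsub>Aff_plus\<^esub>"
  proof
    show "(\<lambda>x. inverse l * x + (- t / l)) \<otimes>\<^bsub>Aff_plus\<^esub> f = \<one>\<^bsub>Aff_plus\<^esub>"
      using f by (auto simp: Aff_plus_def fun_eq_iff field_simps)
    show "(\<lambda>x. inverse l * x + (- t / l)) \<in> carrier Aff_plus"
    proof -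
      have "0 < inverse l" using f by simp
      then show ?thesis unfolding Aff_plus_def by (simp only: partial_object.simps) blast
    qed
  qed
next
  fix f g assume "f \<in> carrier Aff_plus" "g \<in> carrier Aff_plus"
  then obtain l t m s where f: "0 < l" "f = (\<lambda>x. l * x + t)" and g: "0 < m" "g = (\<lambda>x. m * x + s)"
    by (auto simp: Aff_plus_def)
  then have "f \<circ> g = (\<lambda>x. (l * m) * x + (l * s + t))" by (auto simp: fun_eq_iff algebra_simps)
  moreover have "0 < l * m" using f g by simp
  ultimately show "f \<otimes>\<^bsub>Aff_plus\<^esub> g \<in> carrier Aff_plus" unfolding Aff_plus_def by auto
next
  show "\<one>\<^bsub>Aff_plus\<^esub> \<in> carrier Aff_plus"
  proof -
    have "id = (\<lambda>x::real. 1 * x + 0)" "0 < (1::real)" by auto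
    then show ?thesis
      unfolding Aff_plus_def by (simp only: partial_object.simps monoid.simps) blast
  qed
qed (auto simp: Aff_plus_def comp_assoc)

lemma group_GL_rat: "group (GL_rat d)"
proof -
  interpret R: ring "ring_mat TYPE(rat) d ()" by (rule ring_mat)
  show ?thesis by (rule R.units_group)
qed

lemma GL_rat_carrier: "B \<in> carrier (GL_rat d) \<Longrightarrow> B \<in> carrier_mat d d"
  by (auto simp: units_of_def Units_def ring_mat_def)

lemma GL_rat_simps [simp]:
  "B \<otimes>\<^bsub>GL_rat d\<^esub> C = B * C" "\<one>\<^bsub>GL_rat d\<^esub> = 1\<^sub>m d"
  by (auto simp: units_of_def ring_mat_def)

context
  fixes d :: nat and A :: "rat mat" and H :: "rat vec set"
  assumes A: "A \<in> carrier (GL_rat d)"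
    and H: "subgroup H (rat_space d)"
    and AH: "(\<lambda>b. A *\<^sub>v b) ` H = H"
begin

interpretation GL: group "GL_rat d" by (rule group_GL_rat)

lemma int_semidirect_H_carrier: "b \<in> H \<Longrightarrow> b \<in> carrier_vec d"
  using subgroup.mem_carrier[OF H] by (simp add: monoid_vec_def)

lemma int_semidirect_H_add: "b \<in> H \<Longrightarrow> c \<in> H \<Longrightarrow> b + c \<in> H"
  using subgroup.m_closed[OF H] by (simp add: monoid_vec_def)

lemma int_semidirect_H_zero: "0\<^sub>v d \<in> H"
  using subgroup.one_closed[OF H] by (simp add: monoid_vec_def)

lemma int_semidirect_pow_carrier: "A [^]\<^bsub>GL_rat d\<^esub> (m::int) \<in> carrier_mat d d"
  using A by (intro GL_rat_carrier) simp

lemma int_semidirect_pow_mult: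
  "b \<in> carrier_vec d \<Longrightarrow>
    A [^]\<^bsub>GL_rat d\<^esub> (m + n :: int) *\<^sub>v b = A [^]\<^bsub>GL_rat d\<^esub> m *\<^sub>v (A [^]\<^bsub>GL_rat d\<^esub> n *\<^sub>v b)"
  using GL.int_pow_mult[OF A, of m n] int_semidirect_pow_carrier
  by (simp add: assoc_mult_mat_vec[of _ d d _ d])

lemma int_semidirect_pow_1: "A [^]\<^bsub>GL_rat d\<^esub> (1::int) = A"
  using A by (simp add: GL.int_pow_1)

lemma int_semidirect_pow_0: "b \<in> carrier_vec d \<Longrightarrow> A [^]\<^bsub>GL_rat d\<^esub> (0::int) *\<^sub>v b = b"
  by simp

lemma int_semidirect_pow_closed: "b \<in> H \<Longrightarrow> A [^]\<^bsub>GL_rat d\<^esub> (m::int) *\<^sub>v b \<in> H"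
proof (induction m arbitrary: b rule: int_induct[of _ 0])
  case base
  then show ?case using int_semidirect_pow_0 int_semidirect_H_carrier by simp
next
  case (step1 i)
  have "A [^]\<^bsub>GL_rat d\<^esub> (i + 1) *\<^sub>v b = A [^]\<^bsub>GL_rat d\<^esub> i *\<^sub>v (A *\<^sub>v b)"
    using int_semidirect_pow_mult[of b i 1] step1 int_semidirect_H_carrier
    by (simp add: int_semidirect_pow_1)
  then show ?case using step1 AH by auto
next
  case (step2 i)
  from step2(3) AH obtain c where c: "c \<in> H" "b = A *\<^sub>v c" by auto
  have "A [^]\<^bsub>GL_rat d\<^esub> (i - 1) *\<^sub>v b = A [^]\<^bsub>GL_rat d\<^esub> i *\<^sub>v c"
    using int_semidirect_pow_mult[of c "i - 1" 1] c int_semidirect_H_carrier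
    by (simp add: int_semidirect_pow_1)
  then show ?case using step2 c by auto
qed

lemma group_int_semidirect: "group (int_semidirect d A H)"
proof (rule groupI)
  fix x assume "x \<in> carrier (int_semidirect d A H)"
  then obtain m b where x: "x = (m, b)" "b \<in> H" by (auto simp: int_semidirect_def)
  define c where "c = A [^]\<^bsub>GL_rat d\<^esub> (- m) *\<^sub>v b"
  have c: "c \<in> H" using int_semidirect_pow_closed x by (simp add: c_def)
  have "\<exists>c'\<in>H. c' + c = 0\<^sub>v d"
  proof -
    have cc: "c \<in> carrier_vec d" using c int_semidirect_H_carrier by simp
    interpret V: comm_group "rat_space d" by (rule comm_group_vec)
    have "inv\<^bsub>rat_space d\<^esub> c \<in> H" using subgroup.m_inv_closed[OF H c] .
    moreover have "inv\<^bsub>rat_space d\<^esub> c + c = 0\<^sub>v d"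
      using V.l_inv[of c] cc by (simp add: monoid_vec_def)
    ultimately show ?thesis by blast
  qed
  then obtain c' where c': "c' \<in> H" "c' + c = 0\<^sub>v d" by blast
  then show "\<exists>y\<in>carrier (int_semidirect d A H).
      y \<otimes>\<^bsub>int_semidirect d A H\<^esub> x = \<one>\<^bsub>int_semidirect d A H\<^esub>"
    using x c' by (intro bexI[of _ "(- m, c')"]) (auto simp: int_semidirect_def c_def)
next
  fix x y z
  assume "x \<in> carrier (int_semidirect d A H)" "y \<in> carrier (int_semidirect d A H)"
    "z \<in> carrier (int_semidirect d A H)"
  then obtain m b n c k e where *: "x = (m, b)" "b \<in> H" "y = (n, c)" "c \<in> H" "z = (k, e)" "e \<in> H"
    by (auto simp: int_semidirect_def)
  then have bce: "b \<in> carrier_vec d" "c \<in> carrier_vec d" "e \<in> carrier_vec d"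
    using int_semidirect_H_carrier by auto
  show "x \<otimes>\<^bsub>int_semidirect d A H\<^esub> y \<otimes>\<^bsub>int_semidirect d A H\<^esub> z =
        x \<otimes>\<^bsub>int_semidirect d A H\<^esub> (y \<otimes>\<^bsub>int_semidirect d A H\<^esub> z)"
  proof -
    let ?P = "A [^]\<^bsub>GL_rat d\<^esub> m" and ?Q = "A [^]\<^bsub>GL_rat d\<^esub> n"
    have Pc: "?P *\<^sub>v c \<in> carrier_vec d" and Qe: "?Q *\<^sub>v e \<in> carrier_vec d"
      using bce int_semidirect_pow_carrier mult_mat_vec_carrier by blast+
    then have PQe: "?P *\<^sub>v (?Q *\<^sub>v e) \<in> carrier_vec d"
      using int_semidirect_pow_carrier mult_mat_vec_carrier by blast
    have "?P *\<^sub>v (c + ?Q *\<^sub>v e) = ?P *\<^sub>v c + ?P *\<^sub>v (?Q *\<^sub>v e)"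
      using int_semidirect_pow_carrier bce(2) Qe by (rule mult_add_distrib_mat_vec)
    then show ?thesis
      using * bce Pc PQe
      by (simp add: int_semidirect_def int_semidirect_pow_mult assoc_add_vec[of _ d] add.assoc)
  qed
qed (auto simp: int_semidirect_def int_semidirect_H_zero int_semidirect_H_add
      int_semidirect_pow_closed int_semidirect_H_carrier)

lemma int_semidirect_conj:
  assumes b: "b \<in> H"
  shows "int_gen d \<otimes>\<^bsub>int_semidirect d A H\<^esub> of_normal b \<otimes>\<^bsub>int_semidirect d A H\<^esub>
           inv\<^bsub>int_semidirect d A H\<^esub> (int_gen d) = of_normal (A *\<^sub>v b)"
proof -
  let ?G = "int_semidirect d A H"
  interpret G: group ?G by (rule group_int_semidirect)
  have mem: "int_gen d \<in> carrier ?G" "of_normal b \<in> carrier ?G" "of_normal (A *\<^sub>v b) \<in> carrier ?G"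
    using b AH by (auto simp: int_gen_def of_normal_def int_semidirect_def int_semidirect_H_zero)
  have Ab: "A *\<^sub>v b \<in> carrier_vec d"
    using GL_rat_carrier[OF A] int_semidirect_H_carrier[OF b] by auto
  have "int_gen d \<otimes>\<^bsub>?G\<^esub> of_normal b = of_normal (A *\<^sub>v b) \<otimes>\<^bsub>?G\<^esub> int_gen d"
    using Ab by (simp add: int_gen_def of_normal_def int_semidirect_def int_semidirect_pow_1)
  then show ?thesis using mem by (simp add: G.m_assoc)
qed

end

end

theory Submission
  imports Defs
begin

text \<open>
  Let \<open>g\<close> be the inverse of the conjugating homeomorphism, \<open>f\<close> an element of ratio \<open>\<mu> > 1\<close> with
  \<open>f (g x) = g (\<mu> x)\<close>, and \<open>t\<close> an element with \<open>t (g x) = g (x + s)\<close>. Since \<open>1\<close> is not an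
  eigenvalue of \<open>A\<close>, every homomorphism from \<open>H\<close> to the reals that is invariant under \<open>A\<close>
  vanishes; hence elements of \<open>H\<close> act as translations and have derivative \<open>1\<close> at the endpoint
  \<open>1\<close>. Take tiles \<open>g [u, u + s / \<mu>\<^sup>n]\<close> with \<open>u\<close> in a window \<open>[v, v + s]\<close> close to the endpoint.
  Pulling them back by \<open>f\<close> one step at a time and realigning with powers of \<open>t\<close> costs a factor close
  to \<open>1\<close> per step, so their lengths agree up to a factor \<open>K Q\<^sup>n\<close> for any given \<open>Q > 1\<close>. About \<open>\<mu>\<^sup>n\<close> of
  them fill the window, so each has length \<open>\<mu>\<^sup>-\<^sup>n\<close> up to \<open>K Q\<^sup>n\<close>. A power of \<open>t\<close> transports this to
  the tile at the fixed point \<open>g 0\<close>, whose length decays like \<open>f' (g 0)\<^sup>-\<^sup>n\<close>.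
\<close>

section \<open>Derivative at an expanding fixed point\<close>

text \<open>From some \<open>N\<close> on, the growth would be at least \<open>Q\<^sup>2\<close> per
  step, while the bound allows only \<open>Q\<close> per step, so \<open>Q ^ k\<close> would stay
  bounded. This is how a bound valid for every \<open>Q > 1\<close> rules out exponential
  growth.\<close>

lemma not_eventually_ratio_ge:
  fixes x :: "nat \<Rightarrow> real"
  assumes pos: "\<And>n. 0 < x n" and bound: "\<And>n. x n \<le> K * Q ^ n" and "1 < Q"
  shows "\<not> eventually (\<lambda>n. Q\<^sup>2 * x n \<le> x (Suc n)) sequentially"
proof
  assume "eventually (\<lambda>n. Q\<^sup>2 * x n \<le> x (Suc n)) sequentially"
  then obtain N where N: "\<And>n. n \<ge> N \<Longrightarrow> Q\<^sup>2 * x n \<le> x (Suc n)"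
    by (auto simp: eventually_sequentially)
  have grow: "(Q\<^sup>2) ^ k * x N \<le> x (N + k)" for k
  proof (induction k)
    case (Suc k)
    have "(Q\<^sup>2) ^ Suc k * x N = Q\<^sup>2 * ((Q\<^sup>2) ^ k * x N)" by simp
    also have "\<dots> \<le> Q\<^sup>2 * x (N + k)" using Suc by (intro mult_left_mono) auto
    also have "\<dots> \<le> x (N + Suc k)" using N[of "N + k"] by simp
    finally show ?case .
  qed simp
  have "Q ^ k \<le> K * Q ^ N / x N" for k
  proof -
    have "Q ^ k * (Q ^ k * x N) = (Q\<^sup>2) ^ k * x N" 
      by (simp add: power2_eq_square power_mult_distrib)
    also have "\<dots> \<le> K * Q ^ (N + k)" using grow[of k] bound[of "N + k"] by linarith
    also have "\<dots> = Q ^ k * (K * Q ^ N)" by (simp add: power_add)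
    finally have "Q ^ k * x N \<le> K * Q ^ N" using \<open>1 < Q\<close> by simp
    then show ?thesis using pos[of N] by (simp add: field_simps)
  qed
  moreover obtain k where "K * Q ^ N / x N < Q ^ k"
    using real_arch_pow[OF \<open>1 < Q\<close>] by blast
  ultimately show False using not_less by blast
qed

section \<open>Lengths of tiles for an expanding map and a translation in conjugated
  coordinates\<close>

definition comparable :: "real \<Rightarrow> real \<Rightarrow> real \<Rightarrow> bool" where
  "comparable K x y \<longleftrightarrow> x \<le> K * y \<and> y \<le> K * x"

lemma comparable_trans:
  assumes "comparable K x y" "comparable K' y z" "0 \<le> K" "0 \<le> K'"
  shows "comparable (K * K') x z"
proof -
  have "x \<le> K * (K' * z)" "z \<le> K' * (K * x)"
    using assms mult_left_mono[of y "K' * z" K] mult_left_mono[of y "K * x" K']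
    by (auto simp: comparable_def)
  then show ?thesis by (simp add: comparable_def algebra_simps)
qed

lemma comparable_mono:
  assumes "comparable K x y" "K \<le> K'" "0 \<le> x" "0 \<le> y"
  shows "comparable K' x y"
  using assms mult_right_mono[of K K' x] mult_right_mono[of K K' y] by (auto simp: comparable_def)

lemma comparable_sym: "comparable K x y \<Longrightarrow> comparable K y x"
  by (auto simp: comparable_def)

text \<open>The coordinate is centred at the fixed point of \<open>f\<close>, which is why
  \<open>f_g\<close> has no constant term. Since \<open>g\<close> takes values in the open interval,
  differentiability is asked for there only; the endpoint \<open>1\<close> enters through
  \<open>g_lim\<close> and the continuity of \<open>f'\<close> and \<open>t'\<close> up to
  it.\<close>

locale affine_conjugation =
  fixes f f' t t' g :: "real \<Rightarrow> real" and \<mu> s :: real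
  assumes f_deriv: "\<And>x. 0 < x \<Longrightarrow> x < 1 \<Longrightarrow> (f has_real_derivative f' x) (at x)"
    and f'_cont: "continuous_on {0..1} f'"
    and f'_pos: "\<And>x. 0 \<le> x \<Longrightarrow> x \<le> 1 \<Longrightarrow> 0 < f' x"
    and t_deriv: "\<And>x. 0 < x \<Longrightarrow> x < 1 \<Longrightarrow> (t has_real_derivative t' x) (at x)"
    and t'_cont: "continuous_on {0..1} t'"
    and t'_pos: "\<And>x. 0 \<le> x \<Longrightarrow> x \<le> 1 \<Longrightarrow> 0 < t' x"
    and t'_1: "t' 1 = 1"
    and g_mono: "strict_mono g"
    and g_range: "\<And>x. 0 < g x" "\<And>x. g x < 1"
    and g_lim: "(g \<longlongrightarrow> 1) at_top"
    and g_cont: "isCont g 0"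
    and f_g: "\<And>x. f (g x) = g (\<mu> * x)"
    and t_g: "\<And>x. t (g x) = g (x + s)"
    and \<mu>: "1 < \<mu>"
    and s: "0 < s"
begin

text \<open>Length of the tile that is the image of \<open>[u, u + r]\<close>. In these arguments
  \<open>f\<close> multiplies start and width by \<open>\<mu>\<close>, and \<open>t\<close> moves
  the start by \<open>s\<close>.\<close>

definition L :: "real \<Rightarrow> real \<Rightarrow> real" where
  "L u r = g (u + r) - g u"

lemma g_less: "x < y \<Longrightarrow> g x < g y"
  using g_mono by (simp add: strict_mono_less)

lemma g_le: "x \<le> y \<Longrightarrow> g x \<le> g y"
  using g_mono by (simp add: strict_mono_less_eq)

lemma L_pos: "0 < r \<Longrightarrow> 0 < L u r"
  by (simp add: L_def g_less)

text \<open>Mean value theorem on the tile. The intermediate point is kept in the conclusion,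
  because distortion is estimated by comparing derivatives at two such points, and later by letting
  them converge to the fixed point.\<close>

lemma L_scale:
  assumes "0 < r"
  obtains z where "g u < z" "z < g (u + r)" "L (\<mu> * u) (\<mu> * r) = f' z * L u r"
proof -
  have lt: "g u < g (u + r)" using assms g_less by simp
  obtain z where "g u < z" "z < g (u + r)" "f (g (u + r)) - f (g u) = (g (u + r) - g u) * f' z"
    using MVT2[OF lt, of f f'] f_deriv g_range
    by (meson le_less_trans less_le_trans)
  then show ?thesis using that by (simp add: L_def f_g distrib_left mult.commute)
qed

lemma L_shift:
  assumes "0 < r"
  obtains z where "g u < z" "z < g (u + r)" "L (u + s) r = t' z * L u r"
proof -
  have lt: "g u < g (u + r)" using assms g_less by simp
  obtain z where "g u < z" "z < g (u + r)" "t (g (u + r)) - t (g u) = (g (u + r) - g u) * t' z"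
    using MVT2[OF lt, of t t'] t_deriv g_range
    by (meson le_less_trans less_le_trans)
  then show ?thesis using that by (simp add: L_def t_g mult.commute add_ac)
qed

text \<open>Continuity of both derivatives at \<open>1\<close>. The limit of \<open>t'\<close> is
  \<open>1\<close>, so its bounds are absolute; for \<open>f'\<close> only quotients of two values
  are controlled. The threshold has the form \<open>m * s\<close> so that the \<open>m\<close>-th
  power of \<open>t\<close> reaches it from \<open>0\<close>.\<close>

lemma eventually_deriv_close:
  assumes "1 < E"
  obtains m :: nat where
    "\<forall>z\<in>{g (m * s)..<1}. t' z \<le> E \<and> 1 \<le> E * t' z"
    "\<forall>z\<in>{g (m * s)..<1}. \<forall>w\<in>{g (m * s)..<1}. f' z \<le> E * f' w"
proof -
  \<comment> \<open>Each of the two values of \<open>f'\<close> gets a factor \<open>sqrt E\<close>,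
    so that their quotient stays below \<open>E\<close>.\<close>
  have E2: "1 < sqrt E" using assms by simp
  have lim: "(t' \<longlongrightarrow> 1) (at 1 within {0..1})" "(f' \<longlongrightarrow> f' 1) (at 1 within {0..1})"
    using t'_cont f'_cont t'_1 unfolding continuous_on_def by (metis atLeastAtMost_iff order_refl zero_le_one)+
  have f1: "0 < f' 1" using f'_pos by simp
  have "eventually (\<lambda>z. t' z < E) (at 1 within {0..1})"
    by (rule order_tendstoD(2)[OF lim(1)]) (use assms in simp)
  moreover have "eventually (\<lambda>z. 1 / E < t' z) (at 1 within {0..1})"
    by (rule order_tendstoD(1)[OF lim(1)]) (use assms in simp)
  moreover have "eventually (\<lambda>z. f' z < f' 1 * sqrt E) (at 1 within {0..1})"
    by (rule order_tendstoD(2)[OF lim(2)]) (use f1 E2 in simp)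
  moreover have "eventually (\<lambda>z. f' 1 / sqrt E < f' z) (at 1 within {0..1})"
    by (rule order_tendstoD(1)[OF lim(2)]) (use f1 E2 in \<open>simp add: divide_less_eq\<close>)
  ultimately have "eventually (\<lambda>z. t' z < E \<and> 1 / E < t' z \<and> f' z < f' 1 * sqrt E \<and> f' 1 / sqrt E < f' z)
      (at 1 within {0..1})" by eventually_elim auto
  then obtain d where d: "d > 0" and
    dd: "\<And>z. z \<in> {0..1} \<Longrightarrow> z \<noteq> 1 \<Longrightarrow> dist z 1 < d \<Longrightarrow>
      t' z < E \<and> 1 / E < t' z \<and> f' z < f' 1 * sqrt E \<and> f' 1 / sqrt E < f' z"
    by (auto simp: eventually_at)
  have "eventually (\<lambda>x. 1 - d < g x) at_top"
    by (rule order_tendstoD(1)[OF g_lim]) (use d in simp)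
  then obtain b where b: "\<And>x. b \<le> x \<Longrightarrow> 1 - d < g x" by (auto simp: eventually_at_top_linorder)
  obtain m :: nat where "b / s \<le> m" using real_arch_simple by blast
  then have m: "b \<le> m * s" using s by (simp add: field_simps)
  have near: "t' z < E \<and> 1 / E < t' z \<and> f' z < f' 1 * sqrt E \<and> f' 1 / sqrt E < f' z"
    if "g (m * s) \<le> z" "z < 1" for z
  proof (rule dd)
    show "z \<in> {0..1}" using that g_range(1)[of "m * s"] by simp
    show "dist z 1 < d" using that b[OF m] by (simp add: dist_real_def)
  qed (use that in simp)
  show ?thesis
  proof (rule that)
    show "\<forall>z\<in>{g (m * s)..<1}. t' z \<le> E \<and> 1 \<le> E * t' z"
      using near assms by (fastforce simp: field_simps)
    show "\<forall>z\<in>{g (m * s)..<1}. \<forall>w\<in>{g (m * s)..<1}. f' z \<le> E * f' w"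
    proof (intro ballI)
      fix z w assume that: "z \<in> {g (m * s)..<1}" "w \<in> {g (m * s)..<1}"
      have "f' z \<le> f' 1 * sqrt E" using near[of z] that by simp
      also have "\<dots> = E * (f' 1 / sqrt E)" using assms by (simp add: field_simps)
      also have "\<dots> \<le> E * f' w" using near[of w] that assms by (intro mult_left_mono) auto
      finally show "f' z \<le> E * f' w" .
    qed
  qed
qed

text \<open>Each application of \<open>t\<close> multiplies the length by a value of
  \<open>t'\<close> between \<open>1 / E\<close> and \<open>E\<close>. Shifts go to the right only,
  so the intermediate points never leave the region beyond \<open>g v\<close>.\<close>

lemma comparable_shift:
  assumes near: "\<forall>z\<in>{g v..<1}. t' z \<le> E \<and> 1 \<le> E * t' z"
    and "0 \<le> E" "v \<le> u" "0 < r"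
  shows "comparable (E ^ k) (L u r) (L (u + k * s) r)"
proof (induction k)
  case 0
  then show ?case by (simp add: comparable_def)
next
  case (Suc k)
  let ?u = "u + k * s"
  obtain z where z: "g ?u < z" "z < g (?u + r)" "L (?u + s) r = t' z * L ?u r"
    using L_shift[OF \<open>0 < r\<close>] by blast
  have "v \<le> ?u" using \<open>v \<le> u\<close> s by (simp add: add_increasing2)
  then have "g v \<le> z" using z(1) g_le[of v ?u] by linarith
  then have "t' z \<le> E" "1 \<le> E * t' z" using near z(2) g_range(2)[of "?u + r"] by auto
  then have "comparable E (L ?u r) (L (?u + s) r)"
    using z(3) L_pos[OF \<open>0 < r\<close>, of ?u] mult_right_mono[of "t' z" E "L ?u r"]
      mult_right_mono[of 1 "E * t' z" "L ?u r"]
    by (simp add: comparable_def mult.assoc)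
  with Suc have "comparable (E ^ k * E) (L u r) (L (?u + s) r)"
    using comparable_trans \<open>0 \<le> E\<close> by simp
  then show ?case by (simp add: algebra_simps)
qed


lemma tiles_before_shift:
  assumes "u' \<le> u" "u \<le> u' + \<mu> * s"
  obtains k :: nat where "k \<le> nat \<lfloor>\<mu>\<rfloor>" "u' + k * s \<le> u" "u < u' + k * s + s"
proof -
  define q where "q = (u - u') / s"
  have q: "0 \<le> q" "q \<le> \<mu>" "u = u' + q * s"
    using assms s by (auto simp: q_def field_simps)
  have fl: "real (nat \<lfloor>q\<rfloor>) \<le> q" "q < real (nat \<lfloor>q\<rfloor>) + 1"
    using q(1) by linarith+
  show ?thesis
  proof (rule that[of "nat \<lfloor>q\<rfloor>"])
    show "nat \<lfloor>q\<rfloor> \<le> nat \<lfloor>\<mu>\<rfloor>" using q(2) by (intro nat_mono floor_mono)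
    show "u' + nat \<lfloor>q\<rfloor> * s \<le> u" using mult_right_mono[OF fl(1), of s] s q(3) by simp
    show "u < u' + nat \<lfloor>q\<rfloor> * s + s"
      using mult_strict_right_mono[OF fl(2), of s] s q(3) by (simp add: distrib_right)
  qed
qed

text \<open>Induction on the level \<open>n\<close>. At most \<open>J\<close> shifts by
  \<open>s\<close> bring the left tile within distance \<open>s\<close> of the right one, at a cost
  \<open>E ^ J\<close>. Then \<open>f\<close> turns both into tiles of the previous level whose
  starts differ by at most \<open>\<mu> * s\<close>, which is again the distance allowed by the
  claim; comparing \<open>f'\<close> on the two tiles costs one more \<open>E\<close>.\<close>

lemma tiles_comparable:
  assumes near_t: "\<forall>z\<in>{g v..<1}. t' z \<le> E \<and> 1 \<le> E * t' z"
    and near_f: "\<forall>z\<in>{g v..<1}. \<forall>w\<in>{g v..<1}. f' z \<le> E * f' w"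
    and E: "1 \<le> E" and v: "0 \<le> v"
    and J: "J = nat \<lfloor>\<mu>\<rfloor>"
    and u: "v \<le> u'" "u' \<le> u" "u \<le> u' + \<mu> * s"
  shows "comparable (E ^ Suc J * (1 + E) * (E ^ Suc J) ^ n) (L u (s / \<mu> ^ n)) (L u' (s / \<mu> ^ n))"
  using u
proof (induction n arbitrary: u u')
  case 0
  obtain k where k: "k \<le> J" "u' + k * s \<le> u" "u < u' + k * s + s"
    using tiles_before_shift[OF 0(2,3)] J by blast
  define w where "w = u' + k * s"
  have vw: "v \<le> w" "v \<le> u" using 0 s by (auto simp: w_def add_increasing2)
  have shift: "comparable (E ^ k) (L x s) (L (x + k * s) s)" if "v \<le> x" for x and k :: nat
    using comparable_shift[OF near_t _ that s] E by simp
  have w: "w \<le> u" "u < w + s" using k by (auto simp: w_def)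
  have "L w s \<le> E * L (w + s) s" "L (w + s) s \<le> E * L w s"
    using shift[of w 1] vw E by (auto simp: comparable_def)
  moreover have "L (u + s) s \<le> E * L u s"
    using shift[of u 1] vw E by (auto simp: comparable_def)
  \<comment> \<open>As \<open>w \<le> u < w + s\<close>, each tile on the left is covered by the two
    tiles on the right of its inequality.\<close>
  moreover have "L u s \<le> L w s + L (w + s) s" "L (w + s) s \<le> L u s + L (u + s) s"
    using w g_le[of w u] g_le[of "u + s" "w + s + s"] g_le[of u "w + s"] g_le[of "w + s + s" "u + s + s"]
    by (auto simp: L_def)
  ultimately have "L u s \<le> (1 + E) * L w s" "L w s \<le> E * L (w + s) s"
    and "L (w + s) s \<le> (1 + E) * L u s"
    by (auto simp: distrib_right)
  moreover from this(3) have "E * L (w + s) s \<le> E * ((1 + E) * L u s)"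
    using E by (intro mult_left_mono) auto
  moreover have "(1 + E) * L w s \<le> E * ((1 + E) * L w s)"
    using E L_pos[OF s, of w] mult_right_mono[of 1 E "(1 + E) * L w s"] by simp
  ultimately have "comparable (E * (1 + E)) (L u s) (L w s)"
    by (auto simp: comparable_def mult.assoc)
  moreover have "comparable (E ^ J) (L w s) (L u' s)"
  proof (rule comparable_mono[OF comparable_sym])
    show "comparable (E ^ k) (L u' s) (L w s)" unfolding w_def using shift[of u' k] 0 E by simp
    show "E ^ k \<le> E ^ J" using k E by (intro power_increasing)
  qed (use L_pos[OF s] less_imp_le in blast)+
  ultimately have "comparable (E * (1 + E) * E ^ J) (L u s) (L u' s)"
    by (rule comparable_trans) (use E in auto)
  then show ?case by (simp add: algebra_simps)
next
  case (Suc n)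
  obtain k where k: "k \<le> J" "u' + k * s \<le> u" "u < u' + k * s + s"
    using tiles_before_shift[OF Suc(3,4)] J by blast
  define w where "w = u' + k * s"
  define r where "r = s / \<mu> ^ Suc n"
  define K where "K = E ^ Suc J * (1 + E) * (E ^ Suc J) ^ n"
  have r: "0 < r" "\<mu> * r = s / \<mu> ^ n" using s \<mu> by (auto simp: r_def)
  have K: "0 \<le> K" using E by (simp add: K_def)
  have vw: "v \<le> w" "v \<le> u" using Suc(2,3) s by (auto simp: w_def add_increasing2)
  have w: "w \<le> u" "u < w + s" using k by (auto simp: w_def)
  obtain z where z: "g u < z" "z < g (u + r)" "L (\<mu> * u) (\<mu> * r) = f' z * L u r"
    using L_scale[OF r(1)] by blast
  obtain y where y: "g w < y" "y < g (w + r)" "L (\<mu> * w) (\<mu> * r) = f' y * L w r"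
    using L_scale[OF r(1)] by blast
  have zy: "g v \<le> z" "z < 1" "g v \<le> y" "y < 1"
    using z y vw g_le[of v w] g_le[of v u] g_range(2)[of "u + r"] g_range(2)[of "w + r"] by linarith+
  then have pos: "0 < f' z" "0 < f' y"
    using f'_pos g_range(1)[of v] by (meson less_imp_le order_trans)+
  have near_zy: "f' y \<le> E * f' z" "f' z \<le> E * f' y" using near_f zy by auto
  \<comment> \<open>The rescaled tiles stay beyond \<open>v\<close>, because multiplication by
    \<open>\<mu>\<close> does not move the nonnegative start \<open>w\<close> to the left.\<close>
  have "w \<le> \<mu> * w" using vw v \<mu> mult_right_mono[of 1 \<mu> w] by simp
  moreover have "\<mu> * u \<le> \<mu> * w + \<mu> * s"
    using w \<mu> mult_left_mono[of u "w + s" \<mu>] by (simp add: distrib_left)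
  moreover have "\<mu> * w \<le> \<mu> * u" using w \<mu> by simp
  ultimately have "comparable K (L (\<mu> * u) (\<mu> * r)) (L (\<mu> * w) (\<mu> * r))"
    using Suc.IH[of "\<mu> * w" "\<mu> * u"] vw r(2) by (simp add: K_def)
  then have IH: "f' z * L u r \<le> K * (f' y * L w r)" "f' y * L w r \<le> K * (f' z * L u r)"
    by (auto simp: comparable_def z y)
  \<comment> \<open>Replacing \<open>f' y\<close> by \<open>E * f' z\<close>, and conversely, leaves
    the same positive factor on both sides, which then cancels.\<close>
  have "f' z * L u r \<le> f' z * (E * K * L w r)"
    using IH(1) near_zy mult_right_mono[of "f' y" "E * f' z" "K * L w r"] K L_pos[OF r(1), of w]
    by (simp add: algebra_simps)
  moreover have "f' y * L w r \<le> f' y * (E * K * L u r)"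
    using IH(2) near_zy mult_right_mono[of "f' z" "E * f' y" "K * L u r"] K L_pos[OF r(1), of u]
    by (simp add: algebra_simps)
  ultimately have "comparable (E * K) (L u r) (L w r)" using pos by (simp add: comparable_def)
  moreover have "comparable (E ^ J) (L w r) (L u' r)"
  proof (rule comparable_mono[OF comparable_sym])
    show "comparable (E ^ k) (L u' r) (L w r)"
      unfolding w_def using comparable_shift[OF near_t _ _ r(1)] Suc(2) E by simp
    show "E ^ k \<le> E ^ J" using k E by (intro power_increasing)
  qed (use L_pos[OF r(1)] less_imp_le in blast)+
  ultimately have "comparable (E * K * E ^ J) (L u r) (L u' r)"
    by (rule comparable_trans) (use E K in auto)
  then show ?case by (simp add: K_def r_def algebra_simps)
qed

lemma sum_tiles:
  "(\<Sum>i<N. L (u + real i * r) r) = g (u + real N * r) - g u"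
  by (induction N) (auto simp: L_def algebra_simps)

text \<open>Between \<open>0\<close> and \<open>m * s\<close> the derivative \<open>t'\<close> need
  not be near \<open>1\<close>, but by compactness it is bounded and bounded away from
  \<open>0\<close>. The number of shifts is fixed, so \<open>B\<close> does not depend on the width
  \<open>r\<close>.\<close>

lemma shift_to_end:
  obtains B where "0 < B" "\<And>r. 0 < r \<Longrightarrow> comparable B (L 0 r) (L (real m * s) r)"
proof -
  have "compact (t' ` {0..1})" using t'_cont compact_continuous_image by blast
  then have "bounded (t' ` {0..1})" by (rule compact_imp_bounded)
  then obtain b where b: "\<And>x. 0 \<le> x \<Longrightarrow> x \<le> 1 \<Longrightarrow> t' x \<le> b"
    by (force simp: bounded_iff abs_le_iff)
  obtain x where x: "x \<in> {0..1}" "\<And>y. y \<in> {0..1} \<Longrightarrow> t' x \<le> t' y"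
    using continuous_attains_inf[OF compact_Icc _ t'_cont] by auto
  define E where "E = max b (1 / t' x)"
  have tx: "0 < t' x" using x t'_pos by simp
  then have E: "0 < E" by (simp add: E_def less_max_iff_disj)
  have near: "t' z \<le> E \<and> 1 \<le> E * t' z" if "0 \<le> z" "z < 1" for z
  proof
    show "t' z \<le> E" using b[of z] that by (simp add: E_def)
    have "1 = 1 / t' x * t' x" using tx by simp
    also have "\<dots> \<le> E * t' z" using x(2)[of z] that tx E by (intro mult_mono) (auto simp: E_def)
    finally show "1 \<le> E * t' z" .
  qed
  have "comparable (E ^ m) (L 0 r) (L (real m * s) r)" if "0 < r" for r
    using comparable_shift[of 0 E 0 r m] near that E g_range(1)[of 0] by auto
  then show ?thesis using that[of "E ^ m"] E by simp
qed

text \<open>The tiles of width \<open>s / \<mu> ^ n\<close> that fit into the window from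
  \<open>v\<close> to \<open>v + s\<close> have total length between a positive constant and
  \<open>1\<close>. There are about \<open>\<mu> ^ n\<close> of them, comparable up to
  \<open>K1 * Q ^ n\<close>. This gives the length of the tile at \<open>v\<close>, which
  \<open>shift_to_end\<close> transports to \<open>0\<close>.\<close>

lemma comparable_L_0:
  assumes "1 < Q"
  obtains K where "0 < K" "\<And>n. comparable (K * Q ^ n) (L 0 (s / \<mu> ^ n) * \<mu> ^ n) 1"
proof -
  define J where "J = nat \<lfloor>\<mu>\<rfloor>"
  \<comment> \<open>The cost per level is \<open>E ^ Suc J\<close>, so this root makes it exactly
    \<open>Q\<close>.\<close>
  define E where "E = root (Suc J) Q"
  have E: "1 < E" "E ^ Suc J = Q" using assms by (auto simp: E_def simp del: power_Suc)
  obtain m :: nat where m: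
    "\<forall>z\<in>{g (m * s)..<1}. t' z \<le> E \<and> 1 \<le> E * t' z"
    "\<forall>z\<in>{g (m * s)..<1}. \<forall>w\<in>{g (m * s)..<1}. f' z \<le> E * f' w"
    using eventually_deriv_close[OF E(1)] by metis
  define v where "v = m * s"
  have v: "0 \<le> v" using s by (simp add: v_def)
  obtain B where B: "0 < B" "\<And>r. 0 < r \<Longrightarrow> comparable B (L 0 r) (L v r)"
    using shift_to_end unfolding v_def by blast
  define K1 where "K1 = Q * (1 + E)"
  have K1: "0 < K1" using assms E by (simp add: K1_def)
  \<comment> \<open>The number \<open>N\<close> of tiles below is at least
    \<open>\<mu> ^ n / 2\<close>, so at every level they fill at least
    \<open>[v, v + s / 2]\<close>; this bounds their total length from below independently of
    \<open>n\<close>.\<close>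
  define \<delta> where "\<delta> = L v (s / 2)"
  have \<delta>: "0 < \<delta>" using L_pos s by (simp add: \<delta>_def)
  define K where "K = K1 * B * (2 + 1 / \<delta>)"
  have K: "0 < K" "K1 * B * 2 \<le> K" "K1 * B / \<delta> \<le> K"
    using K1 B \<delta> by (auto simp: K_def add_pos_pos algebra_simps)
  have "comparable (K * Q ^ n) (L 0 (s / \<mu> ^ n) * \<mu> ^ n) 1" for n
  proof -
    define r where "r = s / \<mu> ^ n"
    define N where "N = nat \<lfloor>\<mu> ^ n\<rfloor>"
    have \<mu>n: "1 \<le> \<mu> ^ n" using \<mu> by simp
    have "1 \<le> \<lfloor>\<mu> ^ n\<rfloor>" using \<mu>n by simp
    then have N: "real N \<le> \<mu> ^ n" "\<mu> ^ n \<le> 2 * real N" unfolding N_def using \<mu>n by linarith+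
    have r: "0 < r" "\<mu> ^ n * r = s" using s \<mu> by (auto simp: r_def)
    define KQ where "KQ = K1 * Q ^ n"
    have KQ: "0 < KQ" using K1 assms by (simp add: KQ_def)
    have tile: "comparable KQ (L (v + real i * r) r) (L v r)" if "i < N" for i
    proof -
      have "real i * r \<le> \<mu> ^ n * r" using that N(1) r(1) by (intro mult_right_mono) auto
      moreover have "s \<le> \<mu> * s" using \<mu> s by simp
      ultimately have "v + real i * r \<le> v + \<mu> * s" using r(2) by linarith
      moreover have "0 \<le> real i * r" using r(1) by simp
      ultimately show ?thesis
        using tiles_comparable[OF m[folded v_def] _ v J_def, of v "v + real i * r" n] E(1)
        unfolding E(2) r_def[symmetric] by (simp add: KQ_def K1_def)
    qed
    have tot: "(\<Sum>i<N. L (v + real i * r) r) = g (v + real N * r) - g v" by (rule sum_tiles)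
    have "s / 2 \<le> real N * r" using N(2) r mult_right_mono[of "\<mu> ^ n" "2 * real N" r] by simp
    then have tot_ge: "\<delta> \<le> g (v + real N * r) - g v" by (simp add: \<delta>_def L_def g_le)
    have tot_le: "g (v + real N * r) - g v \<le> 1"
      using g_range(2)[of "v + real N * r"] g_range(1)[of v] by linarith
    have L0: "L 0 r \<le> B * L v r" "L v r \<le> B * L 0 r" using B(2)[OF r(1)] by (auto simp: comparable_def)
    have pos: "0 < L v r" "0 < L 0 r" using L_pos r(1) by auto
    have "real N * L v r \<le> (\<Sum>i<N. KQ * L (v + real i * r) r)"
      using sum_mono[of "{..<N}" "\<lambda>_. L v r"] tile by (simp add: comparable_def)
    also have "\<dots> = KQ * (g (v + real N * r) - g v)" unfolding sum_distrib_left[symmetric] tot ..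
    also have "\<dots> \<le> KQ * 1" using tot_le KQ by (intro mult_left_mono) auto
    finally have upper: "real N * L v r \<le> KQ" by simp
    have "L 0 r * \<mu> ^ n \<le> (B * L v r) * (2 * real N)"
      using L0 N(2) pos B(1) \<mu> by (intro mult_mono) auto
    also have "\<dots> = 2 * B * (real N * L v r)" by simp
    also have "\<dots> \<le> 2 * B * KQ" using upper B(1) by (intro mult_left_mono) auto
    also have "\<dots> = K1 * B * 2 * Q ^ n" by (simp add: KQ_def)
    also have "\<dots> \<le> K * Q ^ n" using K(2) assms by (intro mult_right_mono) auto
    finally have A1: "L 0 r * \<mu> ^ n \<le> K * Q ^ n" .
    have "\<delta> \<le> (\<Sum>i<N. L (v + real i * r) r)" using tot tot_ge by simp
    also have "\<dots> \<le> real N * (KQ * L v r)"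
      using sum_mono[of "{..<N}" _ "\<lambda>_. KQ * L v r"] tile by (simp add: comparable_def)
    also have "\<dots> \<le> \<mu> ^ n * (KQ * (B * L 0 r))"
      using N(1) L0(2) pos KQ B(1) \<mu> by (intro mult_mono) auto
    also have "\<dots> = \<delta> * (K1 * B / \<delta> * (Q ^ n * (L 0 r * \<mu> ^ n)))" using \<delta> by (simp add: KQ_def)
    also have "\<dots> \<le> \<delta> * (K * (Q ^ n * (L 0 r * \<mu> ^ n)))"
      using K(3) \<delta> assms pos \<mu> by (intro mult_left_mono mult_right_mono) auto
    finally have "1 \<le> K * (Q ^ n * (L 0 r * \<mu> ^ n))" using \<delta> by simp
    then show ?thesis using A1 by (simp add: comparable_def r_def mult.assoc)
  qed
  then show ?thesis using that K(1) by blast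
qed

text \<open>The normalised lengths \<open>x n\<close> and their inverses are bounded by
  \<open>K * Q ^ n\<close> for every \<open>Q > 1\<close>, while \<open>x (Suc n) / x n\<close>
  equals \<open>\<mu> / f' (z n)\<close> and tends to \<open>\<mu> / f' (g 0)\<close>. A limit other
  than \<open>1\<close> would make \<open>x\<close> or \<open>1 / x\<close> grow
  exponentially.\<close>

theorem deriv_at_fixed_point: "f' (g 0) = \<mu>"
proof (rule ccontr)
  assume neq: "f' (g 0) \<noteq> \<mu>"
  define x where "x = (\<lambda>n. L 0 (s / \<mu> ^ n) * \<mu> ^ n)"
  have r: "0 < s / \<mu> ^ n" for n using s \<mu> by simp
  have x_pos: "0 < x n" for n using L_pos[OF r] \<mu> by (simp add: x_def)
  have "\<exists>z. g 0 < z \<and> z < g (s / \<mu> ^ Suc n) \<and> \<mu> * x n = f' z * x (Suc n)" for n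
  proof -
    obtain z where z: "g 0 < z" "z < g (s / \<mu> ^ Suc n)"
      "L 0 (\<mu> * (s / \<mu> ^ Suc n)) = f' z * L 0 (s / \<mu> ^ Suc n)"
      using L_scale[OF r[of "Suc n"], of 0] by (metis add_0 mult_zero_right)
    have "\<mu> * (s / \<mu> ^ Suc n) = s / \<mu> ^ n" using \<mu> by simp
    then have "\<mu> * x n = f' z * x (Suc n)" using z(3) by (simp add: x_def)
    then show ?thesis using z by blast
  qed
  then obtain z where z: "\<And>n. g 0 < z n" "\<And>n. z n < g (s / \<mu> ^ Suc n)"
    "\<And>n. \<mu> * x n = f' (z n) * x (Suc n)" by metis
  have "(\<lambda>n. s / \<mu> ^ n) \<longlonglongrightarrow> 0" using LIMSEQ_divide_realpow_zero \<mu> by blast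
  then have "(\<lambda>n. s / \<mu> ^ Suc n) \<longlonglongrightarrow> 0" by (rule LIMSEQ_Suc)
  then have "(\<lambda>n. g (s / \<mu> ^ Suc n)) \<longlonglongrightarrow> g 0" using isCont_tendsto_compose[OF g_cont] by blast
  then have z_lim: "z \<longlonglongrightarrow> g 0"
    using z(1,2)
    by (intro tendsto_sandwich[of "\<lambda>_. g 0" z sequentially "\<lambda>n. g (s / \<mu> ^ Suc n)"])
      (simp_all add: less_imp_le)
  have z01: "z n \<in> {0..1}" for n
    using z(1,2)[of n] g_range(1)[of 0] g_range(2)[of "s / \<mu> ^ Suc n"] by simp
  have lim: "(\<lambda>n. f' (z n)) \<longlonglongrightarrow> f' (g 0)"
    using continuous_on_tendsto_compose[OF f'_cont z_lim] z01 g_range[of 0] by (simp add: less_imp_le)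
  have \<alpha>: "0 < f' (g 0)" using f'_pos g_range less_imp_le by blast
  have fz: "0 < f' (z n)" for n using f'_pos z01 by auto
  show False
  proof (cases "f' (g 0) < \<mu>")
    case True
    define q where "q = (f' (g 0) + \<mu>) / 2"
    \<comment> \<open>As \<open>q\<close> separates the limit from \<open>\<mu>\<close>, the
      quotients are eventually at least \<open>\<mu> / q\<close>; the square root brings this to the
      form \<open>Q\<^sup>2\<close>.\<close>
    define Q where "Q = sqrt (\<mu> / q)"
    have q: "f' (g 0) < q" "q < \<mu>" "0 < q" using True \<alpha> by (auto simp: q_def)
    then have Q: "1 < Q" "Q\<^sup>2 = \<mu> / q" using \<mu> by (auto simp: Q_def)
    obtain K where K: "\<And>n. comparable (K * Q ^ n) (x n) 1" using comparable_L_0[OF Q(1)] unfolding x_def by metis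
    have "eventually (\<lambda>n. f' (z n) < q) sequentially" by (rule order_tendstoD(2)[OF lim q(1)])
    then have "eventually (\<lambda>n. Q\<^sup>2 * x n \<le> x (Suc n)) sequentially"
    proof eventually_elim
      case (elim n)
      then have "\<mu> * x n \<le> q * x (Suc n)"
        using z(3)[of n] x_pos[of "Suc n"] by (simp add: mult_right_mono)
      then show ?case using q(3) by (simp add: Q(2) field_simps)
    qed
    then show False using not_eventually_ratio_ge[of x K Q] x_pos K Q(1) by (auto simp: comparable_def)
  next
    case False
    \<comment> \<open>Here the lengths shrink too fast, and the same argument is applied to
      \<open>1 / x n\<close>.\<close>
    define q where "q = (f' (g 0) + \<mu>) / 2"
    define Q where "Q = sqrt (q / \<mu>)"
    have q: "q < f' (g 0)" "\<mu> < q" using False neq by (auto simp: q_def)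
    then have Q: "1 < Q" "Q\<^sup>2 = q / \<mu>" using \<mu> by (auto simp: Q_def)
    obtain K where K: "\<And>n. comparable (K * Q ^ n) (x n) 1" using comparable_L_0[OF Q(1)] unfolding x_def by metis
    have "eventually (\<lambda>n. q < f' (z n)) sequentially" by (rule order_tendstoD(1)[OF lim q(1)])
    then have "eventually (\<lambda>n. Q\<^sup>2 * (1 / x n) \<le> 1 / x (Suc n)) sequentially"
    proof eventually_elim
      case (elim n)
      then have "q * x (Suc n) \<le> \<mu> * x n"
        using z(3)[of n] x_pos[of "Suc n"] by (simp add: mult_right_mono)
      then show ?case using \<mu> x_pos[of n] x_pos[of "Suc n"] by (simp add: Q(2) field_simps)
    qed
    moreover have "1 / x n \<le> K * Q ^ n" for n
      using K[of n] x_pos[of n] by (simp add: comparable_def divide_le_eq)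
    ultimately show False using not_eventually_ratio_ge[of "\<lambda>n. 1 / x n" K Q] x_pos Q(1) by auto
  qed
qed

end

section \<open>Derivatives of increasing diffeomorphisms of the closed interval\<close>

lemma unit_interval_derivative_unique:
  fixes f :: "real \<Rightarrow> real"
  assumes "(f has_real_derivative D) (at x within {0..1})"
    and "(f has_real_derivative E) (at x within {0..1})" and "x \<in> {0..1}"
  shows "D = E"
proof (rule has_field_derivative_unique[OF assms(1,2)])
  show "at x within {0..1} \<noteq> bot"
    using assms(3) by (simp add: trivial_limit_within islimpt_Icc)
qed

text \<open>The composite \<open>k\<close> is prescribed on the interval only, because the elements
  of an action are composed as functions restricted to it.\<close>

lemma unit_interval_derivative_compose:
  fixes f g :: "real \<Rightarrow> real"
  assumes "(f has_real_derivative D) (at (g x) within {0..1})"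
    and "(g has_real_derivative E) (at x within {0..1})" and "g ` {0..1} = {0..1}"
    and "x \<in> {0..1}" and "\<And>y. y \<in> {0..1} \<Longrightarrow> k y = f (g y)"
  shows "(k has_real_derivative D * E) (at x within {0..1})"
proof -
  have "((f \<circ> g) has_real_derivative D * E) (at x within {0..1})"
    by (rule DERIV_image_chain) (use assms in auto)
  then show ?thesis
    by (rule has_field_derivative_transform_within[of _ _ _ _ 1]) (use assms in auto)
qed

lemma unit_interval_endpoints:
  assumes "bij_betw f {0..1::real} {0..1}" "strict_mono_on {0..1::real} f"
  shows "f 0 = 0" "f 1 = (1::real)"
proof -
  have f01: "f x \<in> {0..1}" if "x \<in> {0..1}" for x using that assms(1) by (auto simp: bij_betw_def)
  have le: "f x \<le> f y" if "x \<in> {0..1}" "y \<in> {0..1}" "x \<le> y" for x y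
    using that assms(2) by (simp add: strict_mono_on_leD)
  have "0 \<in> f ` {0..1}" "1 \<in> f ` {0..1}" using assms(1) by (auto simp: bij_betw_def)
  then obtain u v where "u \<in> {0..1}" "f u = 0" "v \<in> {0..1}" "f v = 1" by (metis imageE)
  then show "f 0 = 0" "f 1 = 1"
    using le[of 0 u] le[of v 1] f01[of 0] f01[of 1] by auto
qed

lemma unit_interval_interior:
  fixes f :: "real \<Rightarrow> real"
  assumes "bij_betw f {0..1} {0..1}" "strict_mono_on {0..1} f" "x \<in> {0<..<1}"
  shows "f x \<in> {0<..<1}"
  using strict_mono_onD[OF assms(2), of 0 x] strict_mono_onD[OF assms(2), of x 1] assms(3)
    unit_interval_endpoints[OF assms(1,2)] by auto

text \<open>The chain rule for the inverse after \<open>f\<close> gives a product of derivatives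
  equal to \<open>1\<close>, so the derivative is not zero; as a limit of difference quotients of an
  increasing function it is not negative.\<close>

lemma C1_diffeo_positive_derivative:
  assumes f: "C1_diffeo_on {0..1} f" and mono: "strict_mono_on {0..1} f"
  obtains f' where "\<And>x. x \<in> {0..1} \<Longrightarrow> (f has_real_derivative f' x) (at x within {0..1})"
    "continuous_on {0..1} f'" "\<And>x. x \<in> {0..1} \<Longrightarrow> 0 < f' x"
proof -
  let ?I = "{0..1::real}"
  have bij: "bij_betw f ?I ?I" using f by (simp add: C1_diffeo_on_def)
  obtain f' where f': "\<And>x. x \<in> ?I \<Longrightarrow> (f has_real_derivative f' x) (at x within ?I)"
    "continuous_on ?I f'" using f unfolding C1_diffeo_on_def C1_on_def by blast
  obtain i' where i': "\<And>x. x \<in> ?I \<Longrightarrow> (inv_into ?I f has_real_derivative i' x) (at x within ?I)"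
    using f unfolding C1_diffeo_on_def C1_on_def by blast
  have "0 < f' x" if x: "x \<in> ?I" for x
  proof -
    have fx: "f x \<in> ?I" "f ` ?I = ?I" using bij x by (auto simp: bij_betw_def)
    have "((\<lambda>y. y) has_real_derivative i' (f x) * f' x) (at x within ?I)"
      by (rule unit_interval_derivative_compose[OF i'[OF fx(1)] f'(1)[OF x] fx(2) x])
        (use bij in \<open>simp add: bij_betw_def\<close>)
    then have "i' (f x) * f' x = 1"
      using unit_interval_derivative_unique[OF _ DERIV_ident x] by blast
    then have "f' x \<noteq> 0" by auto
    moreover have "0 \<le> f' x"
    proof (rule tendsto_lowerbound)
      show "((\<lambda>y. (f y - f x) / (y - x)) \<longlongrightarrow> f' x) (at x within ?I)"
        using f'(1)[OF x] by (simp add: has_field_derivative_iff)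
      have "0 \<le> (f y - f x) / (y - x)" if "y \<in> ?I" "y \<noteq> x" for y
        using mono that x strict_mono_onD[of ?I f x y] strict_mono_onD[of ?I f y x]
        by (cases "x < y") (auto simp: zero_le_divide_iff)
      then show "eventually (\<lambda>y. 0 \<le> (f y - f x) / (y - x)) (at x within ?I)"
        by (auto simp: eventually_at_filter)
      show "at x within ?I \<noteq> bot" using x by (simp add: trivial_limit_within islimpt_Icc)
    qed
    ultimately show ?thesis by simp
  qed
  then show ?thesis using that f' by blast
qed

text \<open>The fixed point \<open>x0\<close> of the map \<open>\<mu> * x + c\<close> becomes the
  origin through \<open>k x = g (x + x0)\<close>, which removes \<open>c\<close> and leaves the
  translation by \<open>s\<close> unchanged.\<close>

lemma derivative_at_expanding_fixed_point_mono:
  fixes f t g :: "real \<Rightarrow> real"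
  assumes f: "C1_diffeo_on {0..1} f" "strict_mono_on {0..1} f"
    and t: "C1_diffeo_on {0..1} t" "strict_mono_on {0..1} t"
    and t_1: "(t has_real_derivative 1) (at 1 within {0..1})"
    and g: "strict_mono g" "continuous_on UNIV g" "range g = {0<..<1}"
    and f_g: "\<And>x. f (g x) = g (\<mu> * x + c)" and t_g: "\<And>x. t (g x) = g (x + s)"
    and \<mu>: "1 < \<mu>" and s: "0 < s"
    and p: "p \<in> {0<..<1}" "f p = p"
  shows "(f has_real_derivative \<mu>) (at p)"
proof -
  obtain f' where f': "\<And>x. x \<in> {0..1} \<Longrightarrow> (f has_real_derivative f' x) (at x within {0..1})"
    "continuous_on {0..1} f'" "\<And>x. x \<in> {0..1} \<Longrightarrow> 0 < f' x"
    using C1_diffeo_positive_derivative[OF f] by metis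
  obtain t' where t': "\<And>x. x \<in> {0..1} \<Longrightarrow> (t has_real_derivative t' x) (at x within {0..1})"
    "continuous_on {0..1} t'" "\<And>x. x \<in> {0..1} \<Longrightarrow> 0 < t' x"
    using C1_diffeo_positive_derivative[OF t] by metis
  have interior: "at x within {0..1} = at x" if "0 < x" "x < 1" for x :: real
    using that by (simp add: at_within_Icc_at)
  obtain x0 where x0: "p = g x0" using p(1) g(3) by (metis imageE)
  have x0_fix: "\<mu> * x0 + c = x0"
    using p(2) f_g[of x0] x0 g(1) by (metis strict_mono_eq)
  define k where "k = (\<lambda>x. g (x + x0))"
  have g_range: "0 < g x" "g x < 1" for x using g(3) by (auto simp: set_eq_iff)
  have "(g \<longlongrightarrow> 1) at_top"
  proof (rule order_tendstoI)
    fix y :: real assume y: "y < 1"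
    have "max y 0 < 1" using y by simp
    then obtain z where z: "max y 0 < z" "z < 1" using dense by blast
    then have "z \<in> range g" using g(3) by simp
    then obtain w where "g w = z" by blast
    then have "y < g x" if "w \<le> x" for x
      using z that g(1) by (metis less_le_trans max_less_iff_conj strict_mono_less_eq)
    then show "eventually (\<lambda>x. y < g x) at_top" by (auto simp: eventually_at_top_linorder)
  next
    fix y :: real assume "1 < y"
    then show "eventually (\<lambda>x. g x < y) at_top" using g_range(2) by (meson always_eventually less_trans)
  qed
  then have k_lim: "(k \<longlongrightarrow> 1) at_top"
    unfolding k_def by (rule filterlim_compose) (rule filterlim_tendsto_add_at_top[OF tendsto_const filterlim_ident, of x0, simplified add.commute])
  interpret affine_conjugation f f' t t' k \<mu> s
  proof
    show "(f has_real_derivative f' x) (at x)" if "0 < x" "x < 1" for x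
      using f'(1)[of x] interior that by simp
    show "(t has_real_derivative t' x) (at x)" if "0 < x" "x < 1" for x
      using t'(1)[of x] interior that by simp
    show "t' 1 = 1" using unit_interval_derivative_unique[OF t'(1)[of 1] t_1] by simp
    show "strict_mono k" using g(1) by (simp add: k_def strict_mono_def)
    show "isCont k 0" unfolding k_def using g(2)
      by (intro continuous_intros isCont_o2[of _ "\<lambda>x. x + x0" g]) (auto simp: continuous_on_eq_continuous_at)
    show "f (k x) = k (\<mu> * x)" for x
    proof -
      have "\<mu> * (x + x0) + c = \<mu> * x + x0" using x0_fix by (simp add: distrib_left)
      then show ?thesis by (simp add: k_def f_g)
    qed
    show "t (k x) = k (x + s)" for x by (simp add: k_def t_g add_ac)
  qed (use f' t' k_lim g_range \<mu> s in \<open>auto simp: k_def\<close>)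
  have "f' p = \<mu>" using deriv_at_fixed_point x0 by (simp add: k_def)
  then show ?thesis using f'(1)[of p] p(1) interior by auto
qed

text \<open>The previous lemma needs an increasing parametrisation and a translation to the right.
  If \<open>h'\<close> is decreasing, \<open>y\<close> is replaced by \<open>- y\<close>, which
  changes the signs of \<open>c\<close> and \<open>s\<close>. As \<open>t\<close> and
  \<open>u\<close> translate in opposite directions, one of them fits in every case.\<close>

lemma derivative_at_expanding_fixed_point:
  fixes f t u h h' :: "real \<Rightarrow> real"
  assumes h: "homeomorphism {0<..<1} UNIV h h'"
    and f: "C1_diffeo_on {0..1} f" "strict_mono_on {0..1} f"
    and t: "C1_diffeo_on {0..1} t" "strict_mono_on {0..1} t"
      "(t has_real_derivative 1) (at 1 within {0..1})"
    and u: "C1_diffeo_on {0..1} u" "strict_mono_on {0..1} u"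
      "(u has_real_derivative 1) (at 1 within {0..1})"
    and f_h: "\<And>x. x \<in> {0<..<1} \<Longrightarrow> h (f x) = \<mu> * h x + c"
    and t_h: "\<And>x. x \<in> {0<..<1} \<Longrightarrow> h (t x) = h x + s"
    and u_h: "\<And>x. x \<in> {0<..<1} \<Longrightarrow> h (u x) = h x - s"
    and \<mu>: "1 < \<mu>" and s: "s \<noteq> 0"
    and p: "p \<in> {0<..<1}" "f p = p"
  shows "(f has_real_derivative \<mu>) (at p)"
proof -
  have h': "h' y \<in> {0<..<1}" "h (h' y) = y" for y
    using h by (auto simp: homeomorphism_def)
  have h'_h: "h' (h x) = x" if "x \<in> {0<..<1}" for x using h that by (simp add: homeomorphism_def)
  have cont: "continuous_on UNIV h'" and range_h': "range h' = {0<..<1}"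
    using h by (auto simp: homeomorphism_def)
  have preserves: "k x \<in> {0<..<1}" if "C1_diffeo_on {0..1} k" "strict_mono_on {0..1} k" "x \<in> {0<..<1}"
    for k and x :: real
    using unit_interval_interior[OF _ that(2,3)] that(1) by (simp add: C1_diffeo_on_def)
  have transport: "k (h' y) = h' (h (k (h' y)))"
    if "C1_diffeo_on {0..1} k" "strict_mono_on {0..1} k" for k y
    using h'_h preserves[OF that h'(1)] by simp
  have f_h': "f (h' y) = h' (\<mu> * y + c)" for y using transport[OF f] f_h[OF h'(1)] h'(2) by simp
  have t_h': "t (h' y) = h' (y + s)" for y using transport[OF t(1,2)] t_h[OF h'(1)] h'(2) by simp
  have u_h': "u (h' y) = h' (y - s)" for y using transport[OF u(1,2)] u_h[OF h'(1)] h'(2) by simp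
  have "inj h'" using h'(2) by (metis injI)
  then consider "strict_mono h'" | "strict_antimono_on UNIV h'"
    using injective_eq_monotone_map[of UNIV h'] cont by auto
  then show ?thesis
  proof cases
    case 1
    note key = derivative_at_expanding_fixed_point_mono[OF f _ _ _ 1 cont range_h' f_h' _ \<mu> _ p]
    show ?thesis
    proof (cases "0 < s")
      case True
      then show ?thesis using key[OF t t_h'] by simp
    next
      case False
      then show ?thesis using key[OF u, of "- s"] u_h' s by simp
    qed
  next
    case 2
    define g where "g = (\<lambda>y. h' (- y))"
    have g: "strict_mono g" "continuous_on UNIV g" "range g = {0<..<1}"
    proof -
      show "strict_mono g" 
        using monotone_onD[OF 2] by (auto simp: g_def intro!: strict_monoI)
      show "continuous_on UNIV g" unfolding g_def
        by (intro continuous_on_compose2[OF cont] continuous_intros) auto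
      show "range g = {0<..<1}"
        using range_h' image_image[of h' uminus UNIV] by (simp add: g_def)
    qed
    have f_g: "f (g y) = g (\<mu> * y + - c)" for y by (simp add: g_def f_h')
    note key = derivative_at_expanding_fixed_point_mono[OF f _ _ _ g f_g _ \<mu> _ p]
    show ?thesis
    proof (cases "0 < s")
      case True
      then show ?thesis using key[OF u, of s] by (simp add: g_def u_h')
    next
      case False
      then show ?thesis using key[OF t, of "- s"] s by (simp add: g_def t_h')
    qed
  qed
qed

section \<open>Characters invariant under a matrix\<close>

text \<open>The integer polynomial in \<open>A\<close> with coefficients \<open>c 0\<close> to
  \<open>c n\<close>, applied to \<open>b\<close>. The coefficients are integers because
  \<open>H\<close> is a subgroup and need not be closed under rational scalars.\<close>

primrec orbit_comb :: "rat mat \<Rightarrow> rat vec \<Rightarrow> (nat \<Rightarrow> int) \<Rightarrow> nat \<Rightarrow> rat vec" where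
  "orbit_comb A b c 0 = of_int (c 0) \<cdot>\<^sub>v b"
| "orbit_comb A b c (Suc n) =
    orbit_comb A b c n + of_int (c (Suc n)) \<cdot>\<^sub>v (((\<lambda>x. A *\<^sub>v x) ^^ Suc n) b)"

context
  fixes d :: nat and A :: "rat mat"
  assumes A: "A \<in> carrier_mat d d"
begin

lemma mat_iter_carrier: "b \<in> carrier_vec d \<Longrightarrow> ((\<lambda>x. A *\<^sub>v x) ^^ n) b \<in> carrier_vec d"
  using A by (induction n) auto

lemma orbit_comb_carrier: "b \<in> carrier_vec d \<Longrightarrow> orbit_comb A b c n \<in> carrier_vec d"
  by (induction n) (use A mat_iter_carrier in auto)

lemma orbit_comb_index:
  assumes "b \<in> carrier_vec d" "j < d"
  shows "vec_index (orbit_comb A b c n) j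
    = (\<Sum>i\<le>n. of_int (c i) * vec_index (((\<lambda>x. A *\<^sub>v x) ^^ i) b) j)"
proof (induction n)
  case 0
  then show ?case using assms by simp
next
  case (Suc n)
  have "((\<lambda>x. A *\<^sub>v x) ^^ Suc n) b \<in> carrier_vec d" "orbit_comb A b c n \<in> carrier_vec d"
    using mat_iter_carrier[OF assms(1)] orbit_comb_carrier[OF assms(1)] by blast+
  then show ?case using Suc assms(2) by (simp del: funpow.simps)
qed

text \<open>This is \<open>(1 - X) * \<Sum> e_i X^i = \<Sum> c_i X^i - e_n X^(n+1)\<close>,
  evaluated at \<open>A\<close> and applied to \<open>b\<close>, with the negative terms moved to
  the other side.\<close>

lemma orbit_comb_partial_sums:
  fixes c :: "nat \<Rightarrow> int"
  assumes b: "b \<in> carrier_vec d"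
  defines "e \<equiv> \<lambda>i. \<Sum>j\<le>i. c j"
  shows "orbit_comb A b c n + A *\<^sub>v orbit_comb A b e n
    = orbit_comb A b e n + of_int (e n) \<cdot>\<^sub>v (((\<lambda>x. A *\<^sub>v x) ^^ Suc n) b)"
proof (induction n)
  case 0
  then show ?case using b A by (simp add: e_def mult_mat_vec)
next
  case (Suc n)
  let ?P = "\<lambda>n. ((\<lambda>x. A *\<^sub>v x) ^^ n) b"
  let ?c = "orbit_comb A b c n" and ?e = "orbit_comb A b e n"
  have carP: "?P k \<in> carrier_vec d" for k using mat_iter_carrier[OF b] .
  have car: "?c \<in> carrier_vec d" "?e \<in> carrier_vec d" "A *\<^sub>v ?e \<in> carrier_vec d"
    using mat_iter_carrier[OF b] orbit_comb_carrier[OF b] A by auto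
  have eS: "e (Suc n) = e n + c (Suc n)" by (simp add: e_def)
  have AP: "A *\<^sub>v ?P (Suc n) = ?P (Suc (Suc n))" by simp
  have "A *\<^sub>v (?e + of_int (e (Suc n)) \<cdot>\<^sub>v ?P (Suc n))
      = A *\<^sub>v ?e + of_int (e (Suc n)) \<cdot>\<^sub>v ?P (Suc (Suc n))"
    unfolding AP[symmetric] using A car carP
    by (simp add: mult_add_distrib_mat_vec[of _ d d] mult_mat_vec[of _ d d] del: funpow.simps)
  moreover have "vec_index ?c j + vec_index (A *\<^sub>v ?e) j
      = vec_index ?e j + of_int (e n) * vec_index (?P (Suc n)) j" if "j < d" for j
  proof -
    have "vec_index (?c + A *\<^sub>v ?e) j = vec_index (?e + of_int (e n) \<cdot>\<^sub>v ?P (Suc n)) j"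
      using Suc by simp
    then show ?thesis
      using that carP[of "Suc n"] car A by (simp del: funpow.simps index_mult_mat_vec)
  qed
  ultimately show ?case
    using carP[of "Suc n"] carP[of "Suc (Suc n)"] car A
    by (intro eq_vecI) (auto simp: eS algebra_simps simp del: funpow.simps index_mult_mat_vec)
qed

text \<open>The \<open>d + 1\<close> vectors \<open>b\<close> to \<open>A\<^sup>d b\<close> in
  dimension \<open>d\<close> are dependent over the rationals; clearing denominators makes the
  relation integral.\<close>

lemma orbit_dependent:
  assumes b: "b \<in> carrier_vec d"
  obtains c where "\<exists>i\<le>d. c i \<noteq> 0" "orbit_comb A b c d = 0\<^sub>v d"
proof -
  let ?P = "\<lambda>n. ((\<lambda>x. A *\<^sub>v x) ^^ n) b"
  \<comment> \<open>The orbit vectors are the columns; a zero row makes the matrix square with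
    determinant \<open>0\<close>, so its kernel contains a nonzero vector.\<close>
  define M where "M = mat (Suc d) (Suc d) (\<lambda>(i, j). if i < d then vec_index (?P j) i else 0)"
  have M: "M \<in> carrier_mat (Suc d) (Suc d)" by (simp add: M_def)
  have "M = mat\<^sub>r (Suc d) (Suc d) (\<lambda>i. if i = d then 0\<^sub>v (Suc d) else row M i)"
    by (rule eq_matI) (auto simp: M_def)
  moreover have "Determinant.det \<dots> = 0" by (rule det_row_0) (use M in auto)
  ultimately have "Determinant.det M = 0" by simp
  then obtain v where v: "v \<in> carrier_vec (Suc d)" "v \<noteq> 0\<^sub>v (Suc d)" "M *\<^sub>v v = 0\<^sub>v (Suc d)"
    using det_0_iff_vec_prod_zero[OF M] by blast
  \<comment> \<open>A common multiple of the denominators of the entries of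
    \<open>v\<close>.\<close>
  define N where "N = (\<Prod>i\<le>d. snd (quotient_of (vec_index v i)))"
  have N: "0 < N" unfolding N_def by (intro prod_pos) (simp add: quotient_of_denom_pos')
  have "\<exists>k. of_int N * vec_index v i = of_int k" if "i \<le> d" for i
  proof -
    obtain p q where pq: "quotient_of (vec_index v i) = (p, q)" by fastforce
    have "q dvd N" unfolding N_def using that pq by (metis dvd_prodI finite_atMost atMost_iff snd_conv)
    then obtain m where "N = q * m" by blast
    then have "of_int N * vec_index v i = of_int (m * p)"
      using quotient_of_div[OF pq] quotient_of_denom_pos[OF pq] by simp
    then show ?thesis by blast
  qed
  then obtain c where c: "\<And>i. i \<le> d \<Longrightarrow> of_int N * vec_index v i = of_int (c i)" by metis
  obtain i where "i < Suc d" "vec_index v i \<noteq> 0" using v(1,2) by (metis carrier_vecD eq_vecI index_zero_vec)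
  then have "\<exists>i\<le>d. c i \<noteq> 0" using c[of i] N by (intro exI[of _ i]) auto
  moreover have "orbit_comb A b c d = 0\<^sub>v d"
  proof (rule eq_vecI)
    fix j assume "j < dim_vec (0\<^sub>v d :: rat vec)"
    then have j: "j < d" by simp
    have "vec_index (orbit_comb A b c d) j = (\<Sum>i\<le>d. of_int (c i) * vec_index (?P i) j)"
      by (rule orbit_comb_index[OF b j])
    also have "\<dots> = (\<Sum>i\<le>d. of_int N * (vec_index (?P i) j * vec_index v i))"
      by (rule sum.cong) (simp_all add: c[symmetric])
    also have "\<dots> = of_int N * (\<Sum>i<Suc d. vec_index (?P i) j * vec_index v i)"
      by (simp add: sum_distrib_left lessThan_Suc_atMost)
    also have "(\<Sum>i<Suc d. vec_index (?P i) j * vec_index v i) = vec_index (M *\<^sub>v v) j"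
      using j v(1) M by (simp add: M_def scalar_prod_def atLeast0LessThan del: sum.lessThan_Suc)
    finally show "vec_index (orbit_comb A b c d) j = vec_index (0\<^sub>v d) j" using j v(3) by simp
  qed (use orbit_comb_carrier[OF b] in auto)
  ultimately show ?thesis using that by blast
qed

text \<open>An integral relation \<open>\<Sum>c\<^sub>i A\<^sup>i b = 0\<close> gives \<open>(\<Sum>c\<^sub>i) \<theta> b = 0\<close>. If \<open>\<Sum>c\<^sub>i = 0\<close>, the
  polynomial \<open>\<Sum>c\<^sub>i X\<^sup>i\<close> is divisible by \<open>1 - X\<close>, and the quotient, whose coefficients are the
  partial sums, again annihilates \<open>b\<close>.\<close>

lemma invariant_character_trivial:
  fixes H :: "rat vec set" and \<theta> :: "rat vec \<Rightarrow> real"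
  assumes fix_free: "\<And>x. x \<in> carrier_vec d \<Longrightarrow> A *\<^sub>v x = x \<Longrightarrow> x = 0\<^sub>v d"
    and H: "subgroup H (rat_space d)"
    and AH: "\<And>b. b \<in> H \<Longrightarrow> A *\<^sub>v b \<in> H"
    and \<theta>_add: "\<And>b c. b \<in> H \<Longrightarrow> c \<in> H \<Longrightarrow> \<theta> (b + c) = \<theta> b + \<theta> c"
    and \<theta>_inv: "\<And>b. b \<in> H \<Longrightarrow> \<theta> (A *\<^sub>v b) = \<theta> b"
    and b: "b \<in> H"
  shows "\<theta> b = 0"
proof -
  have H_car: "x \<in> carrier_vec d" if "x \<in> H" for x
    using subgroup.mem_carrier[OF H that] by (simp add: monoid_vec_def)
  have H_add: "x + y \<in> H" if "x \<in> H" "y \<in> H" for x y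
    using subgroup.m_closed[OF H that] by (simp add: monoid_vec_def)
  have H_zero: "0\<^sub>v d \<in> H" using subgroup.one_closed[OF H] by (simp add: monoid_vec_def)
  have \<theta>_zero: "\<theta> (0\<^sub>v d) = 0" using \<theta>_add[OF H_zero H_zero] by simp
  have H_neg: "- x \<in> H" if "x \<in> H" for x
  proof -
    interpret V: comm_group "rat_space d" by (rule comm_group_vec)
    have "inv\<^bsub>rat_space d\<^esub> x = - x"
      using H_car[OF that] by (intro V.inv_equality) (auto simp: monoid_vec_def)
    then show ?thesis using subgroup.m_inv_closed[OF H that] by simp
  qed
  have \<theta>_neg: "\<theta> (- x) = - \<theta> x" if "x \<in> H" for x
    using \<theta>_add[OF H_neg[OF that] that] H_car[OF that] \<theta>_zero by simp
  have nat_smult: "of_nat n \<cdot>\<^sub>v x \<in> H \<and> \<theta> (of_nat n \<cdot>\<^sub>v x) = of_nat n * \<theta> x" if "x \<in> H" for x n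
  proof (induction n)
    case 0
    have "0 \<cdot>\<^sub>v x = 0\<^sub>v d" using H_car[OF that] by auto
    then show ?case using H_zero \<theta>_zero by simp
  next
    case (Suc n)
    have "of_nat (Suc n) \<cdot>\<^sub>v x = x + of_nat n \<cdot>\<^sub>v x" by (simp add: add_smult_distrib_vec)
    then show ?case using Suc that H_add \<theta>_add by (simp add: algebra_simps)
  qed
  have int_smult: "of_int k \<cdot>\<^sub>v x \<in> H \<and> \<theta> (of_int k \<cdot>\<^sub>v x) = of_int k * \<theta> x" if "x \<in> H" for x k
  proof (cases k rule: int_cases2)
    case (nonneg n)
    then show ?thesis using nat_smult[OF that, of n] by simp
  next
    case (nonpos n)
    have "of_int k \<cdot>\<^sub>v x = - (of_nat n \<cdot>\<^sub>v x)" using nonpos by auto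
    then show ?thesis using nat_smult[OF that, of n] nonpos H_neg \<theta>_neg by simp
  qed
  have iter: "((\<lambda>x. A *\<^sub>v x) ^^ n) b \<in> H \<and> \<theta> (((\<lambda>x. A *\<^sub>v x) ^^ n) b) = \<theta> b" for n
    by (induction n) (auto simp: b AH \<theta>_inv)
  have comb: "orbit_comb A b c n \<in> H \<and> \<theta> (orbit_comb A b c n) = of_int (\<Sum>i\<le>n. c i) * \<theta> b" for c n
  proof (induction n)
    case 0
    then show ?case using int_smult[OF b] by simp
  next
    case (Suc n)
    then show ?case using int_smult iter[of "Suc n"] H_add \<theta>_add
      by (simp add: algebra_simps del: funpow.simps)
  qed
  have "\<theta> b = 0" if "\<exists>i\<le>m. c i \<noteq> 0" "orbit_comb A b c m = 0\<^sub>v d" for c m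
    using that
  proof (induction m arbitrary: c)
    case 0
    then show ?case using comb[of c 0] \<theta>_zero by auto
  next
    case (Suc m)
    define e where "e = (\<lambda>i. \<Sum>j\<le>i. c j)"
    show ?case
    proof (cases "e (Suc m) = 0")
      case False
      have "of_int (e (Suc m)) * \<theta> b = 0"
        using comb[of c "Suc m"] \<theta>_zero Suc.prems(2) unfolding e_def by metis
      then show ?thesis using False by simp
    next
      case True
      have ec: "orbit_comb A b e n \<in> carrier_vec d" for n using orbit_comb_carrier H_car[OF b] by blast
      have "orbit_comb A b c (Suc m) + A *\<^sub>v orbit_comb A b e (Suc m) = orbit_comb A b e (Suc m)
          + of_int (e (Suc m)) \<cdot>\<^sub>v (((\<lambda>x. A *\<^sub>v x) ^^ Suc (Suc m)) b)"
        unfolding e_def by (rule orbit_comb_partial_sums[OF H_car[OF b]])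
      moreover have "0 \<cdot>\<^sub>v (((\<lambda>x. A *\<^sub>v x) ^^ Suc (Suc m)) b) = 0\<^sub>v d"
        using mat_iter_carrier[OF H_car[OF b], of "Suc (Suc m)"] by (auto simp del: funpow.simps)
      ultimately have "0\<^sub>v d + A *\<^sub>v orbit_comb A b e (Suc m) = orbit_comb A b e (Suc m) + 0\<^sub>v d"
        unfolding True Suc.prems(2) of_int_0 by (simp only:)
      \<comment> \<open>With \<open>e (Suc m) = 0\<close> the quotient applied to \<open>b\<close>
        is fixed by \<open>A\<close>, hence zero, and its top term vanishes, so it is a relation
        with a smaller degree bound.\<close>
      then have "A *\<^sub>v orbit_comb A b e (Suc m) = orbit_comb A b e (Suc m)"
        using ec[of "Suc m"] A by (metis left_zero_vec right_zero_vec mult_mat_vec_carrier)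
      then have "orbit_comb A b e (Suc m) = 0\<^sub>v d" using fix_free ec by blast
      moreover have "orbit_comb A b e (Suc m) = orbit_comb A b e m"
        using True ec[of m] mat_iter_carrier[OF H_car[OF b], of "Suc m"] by (auto simp del: funpow.simps)
      ultimately have z: "orbit_comb A b e m = 0\<^sub>v d" by metis
      \<comment> \<open>The \<open>c i\<close> are differences of successive \<open>e i\<close>, so
        the smaller relation is again nontrivial.\<close>
      have "\<exists>i\<le>m. e i \<noteq> 0"
      proof (rule ccontr)
        assume "\<not> ?thesis"
        then have e0: "e i = 0" if "i \<le> Suc m" for i using that True by (cases "i = Suc m") auto
        have "c i = 0" if "i \<le> Suc m" for i
        proof (cases i)
          case 0
          then show ?thesis using e0[of 0] by (simp add: e_def)
        next
          case (Suc k)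
          then show ?thesis using e0[of k] e0[of i] that by (simp add: e_def)
        qed
        then show False using Suc.prems(1) by blast
      qed
      then show ?thesis using z by (rule Suc.IH)
    qed
  qed
  moreover obtain c where "\<exists>i\<le>d. c i \<noteq> 0" "orbit_comb A b c d = 0\<^sub>v d"
    using orbit_dependent[OF H_car[OF b]] by metis
  ultimately show ?thesis by metis
qed

end

lemma eigenvalue_1_of_rat:
  assumes A: "A \<in> carrier_mat d d" and x: "x \<in> carrier_vec d" "A *\<^sub>v x = x" "x \<noteq> 0\<^sub>v d"
  shows "eigenvalue (map_mat of_rat A :: complex mat) 1"
proof -
  let ?x = "map_vec of_rat x :: complex vec"
  have "?x \<noteq> 0\<^sub>v d"
  proof
    assume eq: "?x = 0\<^sub>v d"
    have "vec_index x i = 0" if "i < d" for i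
      using arg_cong[OF eq, of "\<lambda>v. vec_index v i"] that x(1) by simp
    then show False using x(1,3) by (metis carrier_vecD eq_vecI index_zero_vec)
  qed
  moreover have "map_vec of_rat (A *\<^sub>v x) = (map_mat of_rat A :: complex mat) *\<^sub>v ?x"
    by (rule of_rat_hom.mult_mat_vec_hom[OF A x(1)])
  then have "map_mat of_rat A *\<^sub>v ?x = 1 \<cdot>\<^sub>v ?x" using x(2) by simp
  ultimately show ?thesis
    unfolding eigenvalue_def eigenvector_def using A x(1) by (intro exI[of _ ?x]) simp
qed

section \<open>Actions of the semidirect product\<close>

locale C1_affine_action =
  fixes d :: nat and A :: "rat mat" and H :: "rat vec set"
    and \<Phi> \<psi> :: "int \<times> rat vec \<Rightarrow> real \<Rightarrow> real" and h h' :: "real \<Rightarrow> real"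
    and G :: "(int \<times> rat vec) monoid" (structure)
  assumes A: "A \<in> carrier (GL_rat d)"
    and no_eigenvalue_1: "\<not> eigenvalue (map_mat of_rat A :: complex mat) 1"
    and H: "subgroup H (rat_space d)"
    and AH: "(\<lambda>b. A *\<^sub>v b) ` H = H"
    and G_def: "G = int_semidirect d A H"
    and action: "group_action G {0..1} \<Phi>"
    and diffeo: "\<And>g. g \<in> carrier G \<Longrightarrow> C1_diffeo_on {0..1} (\<Phi> g)"
    and orient: "\<And>g. g \<in> carrier G \<Longrightarrow> strict_mono_on {0..1} (\<Phi> g)"
    and nonabelian: "\<not> comm_group ((BijGroup {0..1})\<lparr>carrier := \<Phi> ` carrier G\<rparr>)"
    and psi: "\<psi> \<in> hom G Aff_plus"
    and h: "homeomorphism {0<..<1} UNIV h h'"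
    and conj: "\<And>g x. g \<in> carrier G \<Longrightarrow> x \<in> {0<..<1} \<Longrightarrow> h (\<Phi> g x) = \<psi> g (h x)"
begin

sublocale G: group G
  unfolding G_def by (rule group_int_semidirect[OF A H AH])

sublocale act: group_action G "{0..1}" \<Phi> by (rule action)

abbreviation a :: "int \<times> rat vec" where "a \<equiv> int_gen d"

lemma carrier_G: "carrier G = UNIV \<times> H"
  by (simp add: G_def int_semidirect_def)

lemma mem_G [simp]: "b \<in> H \<Longrightarrow> of_normal b \<in> carrier G" "a \<in> carrier G"
  using int_semidirect_H_zero[OF A H AH] by (auto simp: carrier_G of_normal_def int_gen_def)

lemma H_carrier: "b \<in> H \<Longrightarrow> b \<in> carrier_vec d"
  by (rule int_semidirect_H_carrier[OF A H AH])

lemma of_normal_add: "b \<in> H \<Longrightarrow> c \<in> H \<Longrightarrow> of_normal (b + c) = of_normal b \<otimes> of_normal c"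
  using H_carrier by (simp add: of_normal_def G_def int_semidirect_def)

lemma a_commute: "b \<in> H \<Longrightarrow> a \<otimes> of_normal b = of_normal (A *\<^sub>v b) \<otimes> a"
  using H_carrier[of "A *\<^sub>v b"] AH int_semidirect_pow_1[OF A H AH] imageI[of b H "\<lambda>b. A *\<^sub>v b"]
  by (simp add: of_normal_def int_gen_def G_def int_semidirect_def)

lemma mult_G: "(m, b) \<otimes> (n, c) = (m + n, b + (A [^]\<^bsub>GL_rat d\<^esub> m) *\<^sub>v c)"
  by (simp add: G_def int_semidirect_def)

lemma fst_mult: "fst (x \<otimes> y) = fst x + fst y"
  by (cases x; cases y) (simp add: mult_G)

lemma pow_add_zero: "0\<^sub>v d + (A [^]\<^bsub>GL_rat d\<^esub> (m :: int)) *\<^sub>v 0\<^sub>v d = 0\<^sub>v d"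
  using int_semidirect_pow_carrier[OF A H AH, of m] by (intro eq_vecI) auto

lemma a_pow: "a [^] (k :: int) = (k, 0\<^sub>v d)"
proof (induction k rule: int_induct[of _ 0])
  case base
  then show ?case by (simp add: G_def int_semidirect_def)
next
  case (step1 i)
  have "a [^] (i + 1) = a [^] i \<otimes> a" by (simp add: G.int_pow_mult G.int_pow_1)
  also have "\<dots> = (i, 0\<^sub>v d) \<otimes> a" by (simp only: step1)
  finally show ?case by (simp add: int_gen_def mult_G pow_add_zero)
next
  case (step2 i)
  have "(i, 0\<^sub>v d) = (i - 1, 0\<^sub>v d) \<otimes> a"
    by (simp add: int_gen_def mult_G pow_add_zero)
  then have "(i, 0\<^sub>v d) \<otimes> inv a = (i - 1, 0\<^sub>v d) \<otimes> a \<otimes> inv a" by (simp only:)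
  also have "(i - 1, 0\<^sub>v d) \<in> carrier G"
    using int_semidirect_H_zero[OF A H AH] by (simp add: carrier_G)
  then have "(i - 1, 0\<^sub>v d) \<otimes> a \<otimes> inv a = (i - 1, 0\<^sub>v d)" by (simp add: G.m_assoc)
  finally have "(i, 0\<^sub>v d) \<otimes> inv a = (i - 1, 0\<^sub>v d)" .
  moreover have "a [^] (i - 1) = a [^] i \<otimes> inv a"
    by (simp add: G.int_pow_diff G.int_pow_1)
  ultimately show ?case by (simp only: step2)
qed

lemma mem_G_decompose:
  assumes "g \<in> carrier G"
  obtains m :: int and b where "b \<in> H" "g = of_normal b \<otimes> a [^] m"
proof -
  obtain m b where mb: "g = (m, b)" "b \<in> H" using assms by (auto simp: carrier_G)
  then have "g = of_normal b \<otimes> a [^] m"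
    using H_carrier[of b] by (simp add: a_pow of_normal_def mult_G)
  then show ?thesis using that mb by blast
qed

text \<open>The first coordinate is a homomorphism to the integers with kernel \<open>H\<close>, so
  commutators lie in \<open>H\<close>.\<close>

lemma commute_up_to_H:
  assumes "x \<in> carrier G" "y \<in> carrier G"
  obtains b where "b \<in> H" "x \<otimes> y = of_normal b \<otimes> (y \<otimes> x)"
proof -
  let ?c = "x \<otimes> y \<otimes> inv (y \<otimes> x)"
  have c: "?c \<in> carrier G" using assms by simp
  then obtain m b where mb: "?c = (m, b)" "b \<in> H" by (auto simp: carrier_G)
  have eq: "x \<otimes> y = ?c \<otimes> (y \<otimes> x)" using assms by (simp add: G.m_assoc)
  have "fst (?c \<otimes> (y \<otimes> x)) = fst ?c + fst (y \<otimes> x)" by (rule fst_mult)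
  then have "fst (x \<otimes> y) = fst ?c + fst (y \<otimes> x)" by (simp only: eq[symmetric])
  then have "fst ?c = 0" by (simp add: fst_mult)
  then have "?c = of_normal b" using mb by (simp add: of_normal_def)
  then show ?thesis using that[OF mb(2)] eq by metis
qed

text \<open>By \<open>a_commute\<close>, an additive character takes the same value on
  \<open>b\<close> and on \<open>A *\<^sub>v b\<close>, so its restriction to \<open>H\<close> is
  invariant. It is applied to the logarithms of two multiplicative characters: the ratio and the
  derivative at the endpoint \<open>1\<close>.\<close>

lemma character_trivial_on_H:
  fixes \<theta> :: "int \<times> rat vec \<Rightarrow> real"
  assumes mult: "\<And>x y. x \<in> carrier G \<Longrightarrow> y \<in> carrier G \<Longrightarrow> \<theta> (x \<otimes> y) = \<theta> x + \<theta> y"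
    and b: "b \<in> H"
  shows "\<theta> (of_normal b) = 0"
proof (rule invariant_character_trivial[OF GL_rat_carrier[OF A] _ H, of "\<lambda>b. \<theta> (of_normal b)"])
  show "x = 0\<^sub>v d" if "x \<in> carrier_vec d" "A *\<^sub>v x = x" for x
    using eigenvalue_1_of_rat[OF GL_rat_carrier[OF A] that] no_eigenvalue_1 by blast
  show AH': "A *\<^sub>v c \<in> H" if "c \<in> H" for c using AH that by blast
  show "\<theta> (of_normal (b + c)) = \<theta> (of_normal b) + \<theta> (of_normal c)" if "b \<in> H" "c \<in> H" for b c
    using that by (simp add: of_normal_add mult)
  show "\<theta> (of_normal (A *\<^sub>v c)) = \<theta> (of_normal c)" if "c \<in> H" for c
    using mult[of a "of_normal c"] mult[of "of_normal (A *\<^sub>v c)" a] a_commute[OF that] AH'[OF that] that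
    by simp
qed (rule b)

section \<open>Ratios of the affine maps and non-commutativity of the image\<close>

definition ratio :: "int \<times> rat vec \<Rightarrow> real" where "ratio g = aff_ratio (\<psi> g)"

lemma psi_affine:
  assumes "g \<in> carrier G"
  shows "\<psi> g x = ratio g * x + \<psi> g 0" "0 < ratio g"
proof -
  have "\<psi> g \<in> carrier Aff_plus" using psi assms by (auto simp: hom_def)
  then obtain l t where lt: "0 < l" "\<psi> g = (\<lambda>x. l * x + t)" by (auto simp: Aff_plus_def)
  then show "\<psi> g x = ratio g * x + \<psi> g 0" "0 < ratio g" by (simp_all add: ratio_def)
qed

lemma psi_mult:
  assumes "x \<in> carrier G" "y \<in> carrier G"
  shows "\<psi> (x \<otimes> y) z = \<psi> x (\<psi> y z)"
  using hom_mult[OF psi assms] by (simp add: Aff_plus_def)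

lemma ratio_mult:
  assumes "x \<in> carrier G" "y \<in> carrier G"
  shows "ratio (x \<otimes> y) = ratio x * ratio y"
proof -
  have "\<psi> (x \<otimes> y) 1 - \<psi> (x \<otimes> y) 0 = \<psi> x (\<psi> y 1) - \<psi> x (\<psi> y 0)" using psi_mult assms by simp
  moreover have "\<psi> (x \<otimes> y) 1 - \<psi> (x \<otimes> y) 0 = ratio (x \<otimes> y)"
    using psi_affine(1)[of "x \<otimes> y" 1] assms by simp
  moreover have "\<psi> x (\<psi> y 1) - \<psi> x (\<psi> y 0) = ratio x * ratio y"
    using psi_affine(1)[of x "\<psi> y 1"] psi_affine(1)[of x "\<psi> y 0"] psi_affine(1)[of y 1] assms
    by (simp add: algebra_simps)
  ultimately show ?thesis by simp
qed

lemma ratio_of_normal: "b \<in> H \<Longrightarrow> ratio (of_normal b) = 1"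
  using character_trivial_on_H[of "\<lambda>g. ln (ratio g)" b] ratio_mult psi_affine(2)
  by (simp add: ln_mult_pos)

lemma ratio_one: "ratio \<one> = 1"
  using ratio_mult[of \<one> \<one>] psi_affine(2)[of \<one>] by simp

lemma ratio_inv: "x \<in> carrier G \<Longrightarrow> ratio (inv x) = inverse (ratio x)"
  using ratio_mult[of "inv x" x] ratio_one psi_affine(2)[of x] by (simp add: field_simps)

lemma ratio_a_pow: "ratio (a [^] (k :: int)) = ratio a powi k"
proof (induction k rule: int_induct[of _ 0])
  case base
  then show ?case by (simp add: ratio_one)
next
  case (step1 i)
  then show ?case
    using psi_affine(2)[of a] by (simp add: G.int_pow_mult G.int_pow_1 ratio_mult power_int_add)
next
  case (step2 i)
  then show ?case
    using psi_affine(2)[of a]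
    by (simp add: G.int_pow_diff G.int_pow_1 ratio_mult ratio_inv power_int_diff divide_inverse)
qed

lemma preserves_interior: "g \<in> carrier G \<Longrightarrow> x \<in> {0<..<1} \<Longrightarrow> \<Phi> g x \<in> {0<..<1}"
  using diffeo orient unit_interval_interior by (simp add: C1_diffeo_on_def)

lemma fixed_endpoints: "g \<in> carrier G \<Longrightarrow> \<Phi> g 0 = 0" "g \<in> carrier G \<Longrightarrow> \<Phi> g 1 = 1"
  using diffeo orient unit_interval_endpoints by (auto simp: C1_diffeo_on_def)

lemma h_inj: "x \<in> {0<..<1} \<Longrightarrow> y \<in> {0<..<1} \<Longrightarrow> h x = h y \<Longrightarrow> x = y"
  using h by (metis homeomorphism_def)

text \<open>Off the interval both maps take the default value, the endpoints are fixed by every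
  element, and inside \<open>h\<close> is injective. This carries non-commutativity over from the
  diffeomorphisms to the affine maps.\<close>

lemma Phi_eqI:
  assumes xy: "x \<in> carrier G" "y \<in> carrier G" and eq: "\<psi> x = \<psi> y"
  shows "\<Phi> x = \<Phi> y"
proof (rule extensionalityI[of _ "{0..1}"])
  show "\<Phi> x \<in> extensional {0..1}" "\<Phi> y \<in> extensional {0..1}"
    using act.bij_prop0 xy Bij_imp_extensional by blast+
  fix z :: real assume "z \<in> {0..1}"
  then consider "z = 0" | "z = 1" | "z \<in> {0<..<1}" by fastforce
  then show "\<Phi> x z = \<Phi> y z"
  proof cases
    case 3
    show ?thesis by (rule h_inj) (use preserves_interior xy 3 conj eq in auto)
  qed (use fixed_endpoints xy in auto)
qed

lemma psi_not_commuting: "\<not> (\<forall>x\<in>carrier G. \<forall>y\<in>carrier G. \<psi> (x \<otimes> y) = \<psi> (y \<otimes> x))"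
proof
  assume comm: "\<forall>x\<in>carrier G. \<forall>y\<in>carrier G. \<psi> (x \<otimes> y) = \<psi> (y \<otimes> x)"
  interpret \<Phi>: group_hom G "BijGroup {0..1}" \<Phi> by (rule act.group_hom)
  interpret I: group "(BijGroup {0..1})\<lparr>carrier := \<Phi> ` carrier G\<rparr>"
    using \<Phi>.img_is_subgroup \<Phi>.H.subgroup_imp_group by blast
  have "comm_group ((BijGroup {0..1})\<lparr>carrier := \<Phi> ` carrier G\<rparr>)"
  proof (rule I.group_comm_groupI)
    fix u v
    assume "u \<in> carrier ((BijGroup {0..1})\<lparr>carrier := \<Phi> ` carrier G\<rparr>)"
      and "v \<in> carrier ((BijGroup {0..1})\<lparr>carrier := \<Phi> ` carrier G\<rparr>)"
    then obtain x y where xy: "x \<in> carrier G" "u = \<Phi> x" "y \<in> carrier G" "v = \<Phi> y" by auto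
    then have "\<Phi> (x \<otimes> y) = \<Phi> (y \<otimes> x)" using comm by (intro Phi_eqI) auto
    then show "u \<otimes>\<^bsub>(BijGroup {0..1})\<lparr>carrier := \<Phi> ` carrier G\<rparr>\<^esub> v
      = v \<otimes>\<^bsub>(BijGroup {0..1})\<lparr>carrier := \<Phi> ` carrier G\<rparr>\<^esub> u"
      using xy by simp
  qed
  then show False using nonabelian by contradiction
qed

text \<open>If \<open>a\<close> acted as a translation, so would all of \<open>G\<close>, and
  translations commute.\<close>

lemma ratio_a_neq_1: "ratio a \<noteq> 1"
proof
  assume "ratio a = 1"
  then have "ratio (a [^] m) = 1" for m :: int by (simp add: ratio_a_pow)
  then have ratio: "ratio g = 1" if "g \<in> carrier G" for g
    using mem_G_decompose[OF that] ratio_of_normal ratio_mult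
    by (metis G.int_pow_closed mem_G mult_1)
  have "\<psi> (x \<otimes> y) z = \<psi> (y \<otimes> x) z" if xy: "x \<in> carrier G" "y \<in> carrier G" for x y z
    using psi_affine(1)[OF xy(1), of "\<psi> y z"] psi_affine(1)[OF xy(2), of "\<psi> x z"]
      psi_affine(1)[OF xy(1), of z] psi_affine(1)[OF xy(2), of z] ratio xy
    by (simp add: psi_mult)
  then show False using psi_not_commuting by auto
qed

text \<open>If \<open>H\<close> acted trivially, \<open>x \<otimes> y\<close> and
  \<open>y \<otimes> x\<close> would act alike, as they differ by an element of
  \<open>H\<close>.\<close>

lemma exists_translation:
  obtains b where "b \<in> H" "\<psi> (of_normal b) 0 \<noteq> 0"
proof (rule ccontr)
  assume "\<not> thesis"
  then have "\<forall>b\<in>H. \<psi> (of_normal b) 0 = 0" using that by blast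
  then have id: "\<psi> (of_normal b) z = z" if "b \<in> H" for b z
    using psi_affine(1)[of "of_normal b" z] ratio_of_normal that by simp
  have "\<psi> (x \<otimes> y) = \<psi> (y \<otimes> x)" if xy: "x \<in> carrier G" "y \<in> carrier G" for x y
  proof
    fix z
    obtain b where "b \<in> H" "x \<otimes> y = of_normal b \<otimes> (y \<otimes> x)" using commute_up_to_H[OF xy] by blast
    then show "\<psi> (x \<otimes> y) z = \<psi> (y \<otimes> x) z" using xy by (simp add: psi_mult[of "of_normal b"] id)
  qed
  then show False using psi_not_commuting by blast
qed

section \<open>Derivatives at the endpoint and at interior fixed points\<close>

definition endpoint_deriv :: "int \<times> rat vec \<Rightarrow> real" where
  "endpoint_deriv g = (THE D. (\<Phi> g has_real_derivative D) (at 1 within {0..1}))"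

lemma endpoint_deriv:
  assumes "g \<in> carrier G"
  shows "(\<Phi> g has_real_derivative endpoint_deriv g) (at 1 within {0..1})" "0 < endpoint_deriv g"
proof -
  obtain f' where f': "(\<Phi> g has_real_derivative f' 1) (at 1 within {0..1})" "0 < f' (1 :: real)"
    using C1_diffeo_positive_derivative[OF diffeo orient] assms
    by (metis atLeastAtMost_iff order_refl zero_le_one)
  moreover from this have "endpoint_deriv g = f' 1"
    unfolding endpoint_deriv_def
    by (intro the_equality) (auto intro: unit_interval_derivative_unique)
  ultimately show "(\<Phi> g has_real_derivative endpoint_deriv g) (at 1 within {0..1})"
    "0 < endpoint_deriv g" by auto
qed

lemma endpoint_deriv_mult:
  assumes "x \<in> carrier G" "y \<in> carrier G"
  shows "endpoint_deriv (x \<otimes> y) = endpoint_deriv x * endpoint_deriv y"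
proof -
  have "(\<Phi> (x \<otimes> y) has_real_derivative endpoint_deriv x * endpoint_deriv y) (at 1 within {0..1})"
    by (rule unit_interval_derivative_compose[where f = "\<Phi> x" and g = "\<Phi> y"])
      (use assms endpoint_deriv(1) act.surj_prop act.composition_rule fixed_endpoints in auto)
  then show ?thesis
    using endpoint_deriv(1)[of "x \<otimes> y"] assms unit_interval_derivative_unique by fastforce
qed

lemma endpoint_deriv_of_normal: "b \<in> H \<Longrightarrow> endpoint_deriv (of_normal b) = 1"
  using character_trivial_on_H[of "\<lambda>g. ln (endpoint_deriv g)" b] endpoint_deriv_mult endpoint_deriv(2)
  by (simp add: ln_mult_pos)

text \<open>An element of \<open>H\<close> acting as a nontrivial translation serves as
  \<open>t\<close>, its inverse as \<open>u\<close>; both have derivative \<open>1\<close> at the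
  endpoint.\<close>

lemma deriv_at_expanding:
  assumes g: "g \<in> carrier G" "1 < ratio g" and p: "p \<in> {0<..<1}" "\<Phi> g p = p"
  shows "(\<Phi> g has_real_derivative ratio g) (at p)"
proof -
  obtain b where b: "b \<in> H" "\<psi> (of_normal b) 0 \<noteq> 0" by (rule exists_translation)
  let ?t = "of_normal b" and ?u = "inv (of_normal b)"
  have tu: "?t \<in> carrier G" "?u \<in> carrier G" using b by simp_all
  have "\<psi> ?t (\<psi> ?u z) = \<psi> \<one> z" for z using psi_mult[OF tu, of z] tu by simp
  moreover have "\<psi> \<one> z = z" for z
  proof -
    \<comment> \<open>An idempotent translation is the identity.\<close>
    have "\<psi> \<one> (\<psi> \<one> z) = \<psi> \<one> z" using psi_mult[of \<one> \<one> z] by simp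
    then show ?thesis using psi_affine(1)[of \<one> z] psi_affine(1)[of \<one> "\<psi> \<one> z"] ratio_one by simp
  qed
  moreover have t: "\<psi> ?t z = z + \<psi> ?t 0" for z
    using psi_affine(1)[of ?t z] ratio_of_normal b by simp
  ultimately have u: "\<psi> ?u z = z - \<psi> ?t 0" for z by (metis add_diff_cancel)
  have "endpoint_deriv ?u = 1"
    using endpoint_deriv_mult[OF tu] endpoint_deriv_mult[of \<one> \<one>] endpoint_deriv(2)[of \<one>]
      endpoint_deriv_of_normal[OF b(1)] tu by simp
  then have "(\<Phi> ?u has_real_derivative 1) (at 1 within {0..1})"
    using endpoint_deriv(1)[OF tu(2)] by simp
  moreover have "(\<Phi> ?t has_real_derivative 1) (at 1 within {0..1})"
    using endpoint_deriv(1)[OF tu(1)] endpoint_deriv_of_normal[OF b(1)] by simp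
  moreover have "h (\<Phi> g x) = ratio g * h x + \<psi> g 0" if "x \<in> {0<..<1}" for x
    by (rule trans[OF conj[OF g(1) that] psi_affine(1)[OF g(1)]])
  moreover have "h (\<Phi> ?t x) = h x + \<psi> ?t 0" if "x \<in> {0<..<1}" for x
    by (rule trans[OF conj[OF tu(1) that] t])
  moreover have "h (\<Phi> ?u x) = h x - \<psi> ?t 0" if "x \<in> {0<..<1}" for x
    by (rule trans[OF conj[OF tu(2) that] u])
  ultimately show ?thesis
    using diffeo orient g tu b(2) p
    by (intro derivative_at_expanding_fixed_point[OF h, of "\<Phi> g" "\<Phi> ?t" "\<Phi> ?u"]) auto
qed

text \<open>If the ratio is below \<open>1\<close>, the inverse is expanding with the same fixed
  point, and the chain rule there gives the reciprocal of its derivative.\<close>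

lemma deriv_at_fixed_point:
  assumes g: "g \<in> carrier G" "ratio g \<noteq> 1" and p: "p \<in> {0<..<1}" "\<Phi> g p = p"
  shows "(\<Phi> g has_real_derivative ratio g) (at p)"
proof (cases "1 < ratio g")
  case True
  then show ?thesis using deriv_at_expanding assms by blast
next
  case False
  have p01: "p \<in> {0..1}" and interior: "at p within {0..1} = at p"
    using p(1) by (auto simp: at_within_Icc_at)
  have gi: "inv g \<in> carrier G" using g by simp
  have inv_g: "\<Phi> (inv g) (\<Phi> g x) = x" if "x \<in> {0..1}" for x
    using act.composition_rule[OF that gi g(1)] act.id_eq_one that g(1)
    by (metis G.l_inv restrict_apply')
  have "1 < ratio (inv g)"
    using False g(2) psi_affine(2)[OF g(1)] by (simp add: ratio_inv[OF g(1)] one_less_inverse)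
  then have "(\<Phi> (inv g) has_real_derivative ratio (inv g)) (at p)"
    using deriv_at_expanding[OF gi _ p(1)] inv_g[OF p01] p(2) by simp
  moreover obtain f' where f': "(\<Phi> g has_real_derivative f' p) (at p within {0..1})"
    using C1_diffeo_positive_derivative[OF diffeo orient] g(1) p01 by metis
  ultimately have "((\<lambda>x. x) has_real_derivative ratio (inv g) * f' p) (at p within {0..1})"
    using p(2) p01 interior act.surj_prop[OF g(1)] inv_g
    by (intro unit_interval_derivative_compose[where f = "\<Phi> (inv g)" and g = "\<Phi> g"]) auto
  then have "ratio (inv g) * f' p = 1"
    using unit_interval_derivative_unique[OF _ DERIV_ident p01] by blast
  then have "f' p = ratio g"
    using psi_affine(2)[OF g(1)] by (simp add: ratio_inv[OF g(1)] field_simps)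
  then show ?thesis using f' interior by simp
qed

text \<open>A homothety of the line has exactly one fixed point, here \<open>q\<close>, and
  \<open>h'\<close> carries it back to the interval.\<close>

lemma unique_fixed_point:
  assumes g: "g \<in> carrier G" "ratio g \<noteq> 1"
  shows "\<exists>!p. p \<in> {0<..<1} \<and> \<Phi> g p = p"
proof -
  define q where "q = \<psi> g 0 / (1 - ratio g)"
  have fixed_iff: "\<psi> g y = y \<longleftrightarrow> y = q" for y
    using g(2) psi_affine(1)[OF g(1), of y] by (auto simp: q_def field_simps)
  have iff: "\<Phi> g p = p \<longleftrightarrow> h p = q" if "p \<in> {0<..<1}" for p
    using conj[OF g(1) that] h_inj[OF preserves_interior[OF g(1) that] that] fixed_iff by metis
  have "h' q \<in> {0<..<1}" "h (h' q) = q" using h by (auto simp: homeomorphism_def)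
  then show ?thesis using iff h_inj by (intro ex1I[of _ "h' q"]) auto
qed

end

theorem theorem1p7:
  fixes d :: nat and A :: "rat mat" and H :: "rat vec set"
    and \<Phi> :: "int \<times> rat vec \<Rightarrow> real \<Rightarrow> real" and \<psi> :: "int \<times> rat vec \<Rightarrow> real \<Rightarrow> real"
    and G :: "(int \<times> rat vec) monoid" and a :: "int \<times> rat vec" and lam :: real
  assumes d: "d \<ge> 1"
    and A: "A \<in> carrier (GL_rat d)"
    and A_hyp: "\<And>\<mu>. eigenvalue (map_mat of_rat A :: complex mat) \<mu> \<Longrightarrow> cmod \<mu> \<noteq> 1"
    and H: "subgroup H (rat_space d)"
    and AH: "(\<lambda>b. A *\<^sub>v b) ` H = H"
    and rank_H: "rat_rank ((rat_space d)\<lparr>carrier := H\<rparr>) = d"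
    and G_def: "G = int_semidirect d A H"
    and a_def: "a = int_gen d"
    and action: "group_action G {0..1} \<Phi>"
    and diffeo: "\<And>g. g \<in> carrier G \<Longrightarrow> C1_diffeo_on {0..1} (\<Phi> g)"
    and orient: "\<And>g. g \<in> carrier G \<Longrightarrow> strict_mono_on {0..1} (\<Phi> g)"
    and no_global_fix: "\<not> (\<exists>x\<in>{0<..<1}. \<forall>g\<in>carrier G. \<Phi> g x = x)"
    and nonabelian: "\<not> comm_group ((BijGroup {0..1})\<lparr>carrier := \<Phi> ` carrier G\<rparr>)"
    and psi: "\<psi> \<in> hom G Aff_plus"
    and conj: "topologically_conjugate_to G \<Phi> \<psi>"
    and lam: "lam = aff_ratio (\<psi> a)"
  shows "(\<exists>!p. p \<in> {0<..<1} \<and> \<Phi> a p = p) \<and>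
         (\<forall>p\<in>{0<..<1}. \<Phi> a p = p \<longrightarrow> (\<Phi> a has_real_derivative lam) (at p)) \<and>
         (\<forall>k b. k \<noteq> 0 \<and> b \<in> H \<longrightarrow>
            (let g = a [^]\<^bsub>G\<^esub> (k::int) \<otimes>\<^bsub>G\<^esub> of_normal b in
              (\<exists>!p. p \<in> {0<..<1} \<and> \<Phi> g p = p) \<and>
              (\<forall>p\<in>{0<..<1}. \<Phi> g p = p \<longrightarrow> (\<Phi> g has_real_derivative (lam powi k)) (at p))))"
proof -
  obtain h h' where h: "homeomorphism {0<..<1} UNIV h h'"
    and h_conj: "\<forall>g\<in>carrier G. \<forall>x\<in>{0<..<1}. h (\<Phi> g x) = \<psi> g (h x)"
    using conj by (auto simp: topologically_conjugate_to_def)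
  interpret C1_affine_action d A H \<Phi> \<psi> h h' G
    using A_hyp[of 1] h_conj
    by (intro C1_affine_action.intro A H AH G_def action diffeo orient nonabelian psi h) auto
  have lam_ratio: "lam = ratio a" by (simp add: lam ratio_def)
  have a: "a \<in> carrier G" by (simp add: a_def)
  have lam_ne: "lam \<noteq> 1" "0 < lam"
    using ratio_a_neq_1 psi_affine(2) mem_G(2) by (auto simp: lam_ratio a_def)
  have pow_ne: "lam powi k \<noteq> 1" if "k \<noteq> 0" for k :: int
  proof -
    \<comment> \<open>The logarithm turns the claim into
      \<open>k * ln lam \<noteq> 0\<close>.\<close>
    have "ln (lam powi k) = of_int k * ln lam"
      using lam_ne(2) by (cases k rule: int_cases2) (simp_all add: power_int_minus ln_realpow ln_inverse)
    moreover have "of_int k * ln lam \<noteq> 0" using that lam_ne by simp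
    ultimately show ?thesis by auto
  qed
  have pow: "a [^]\<^bsub>G\<^esub> k \<otimes>\<^bsub>G\<^esub> of_normal b \<in> carrier G"
    "ratio (a [^]\<^bsub>G\<^esub> k \<otimes>\<^bsub>G\<^esub> of_normal b) = lam powi k" if "b \<in> H" for k :: int and b
    using that a ratio_a_pow[of k] ratio_of_normal
    by (auto simp: ratio_mult lam_ratio a_def)
  \<comment> \<open>Formulated by ratio, this covers \<open>a\<close> and all the elements
    \<open>a\<^sup>k b\<close> at once.\<close>
  have fixed_point: "(\<exists>!p. p \<in> {0<..<1} \<and> \<Phi> g p = p) \<and>
      (\<forall>p\<in>{0<..<1}. \<Phi> g p = p \<longrightarrow> (\<Phi> g has_real_derivative r) (at p))"
    if "g \<in> carrier G" "ratio g = r" "r \<noteq> 1" for g r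
    using unique_fixed_point[of g] deriv_at_fixed_point[of g] that by blast
  have "\<forall>k b. k \<noteq> 0 \<and> b \<in> H \<longrightarrow>
      (let g = a [^]\<^bsub>G\<^esub> (k::int) \<otimes>\<^bsub>G\<^esub> of_normal b in
        (\<exists>!p. p \<in> {0<..<1} \<and> \<Phi> g p = p) \<and>
        (\<forall>p\<in>{0<..<1}. \<Phi> g p = p \<longrightarrow> (\<Phi> g has_real_derivative (lam powi k)) (at p)))"
  proof (intro allI impI, unfold Let_def, elim conjE)
    fix k :: int and b assume "k \<noteq> 0" "b \<in> H"
    then show "(\<exists>!p. p \<in> {0<..<1} \<and> \<Phi> (a [^]\<^bsub>G\<^esub> k \<otimes>\<^bsub>G\<^esub> of_normal b) p = p) \<and>
        (\<forall>p\<in>{0<..<1}. \<Phi> (a [^]\<^bsub>G\<^esub> k \<otimes>\<^bsub>G\<^esub> of_normal b) p = p \<longrightarrow>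
          (\<Phi> (a [^]\<^bsub>G\<^esub> k \<otimes>\<^bsub>G\<^esub> of_normal b) has_real_derivative (lam powi k)) (at p))"
      by (intro fixed_point[OF pow pow_ne])
  qed
  moreover note fixed_point[OF a lam_ratio[symmetric] lam_ne(1)]
  ultimately show ?thesis by (elim conjE) (intro conjI)
qed

end
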